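(* Let $\sigma:\Sigma\to\Sigma$ be a transitive one-sided subshift of finite type. For each potential $A\in C^\theta(\hat\Sigma)$ there exists a function $u\in C^\theta(\Sigma)$ such that, for every $\mathbf x\in\Sigma$, $$u(\mathbf x)=\min_{\mathbf y\in\Sigma^*_{\mathbf x}}\bigl[u(\tau_{\mathbf y}(\mathbf x))-A(\mathbf y,\mathbf x)+\beta_A\bigr].$$
   Context: Let $\mathbf M$ be an $r\times r$ matrix with entries in $\{0,1\}$. The one-sided subshift of finite type is $\Sigma=\{\mathbf x=(x_0,x_1,\ldots)\in\{1,\ldots,r\}^{\mathbb N}:\mathbf M(x_j,x_{j+1})=1\ \forall j\ge 0\}$ (nonempty), with the left shift $\sigma(x_0,x_1,\ldots)=(x_1,x_2,\ldots)$. Fix $\lambda\in(0,1)$; $\Sigma$ has the metric $d(\mathbf x,\bar{\mathbf x})=\lambda^{k}$, $k=\min\{j:x_j\ne\bar x_j\}$ (and $d(\mathbf x,\mathbf x)=0$). The dual space is $\Sigma^*=\{\mathbf y=(\ldots,y_1,y_0)\in\{1,\ldots,r\}^{\mathbb N}:\mathbf M(y_{j+1},y_j)=1\ \forall j\ge0\}$, with the analogous metric. Let $\hat\Sigma=\{(\mathbf y,\mathbf x)\in\Sigma^*\times\Sigma:\mathbf M(y_0,x_0)=1\}$, with the maximum metric induced from the product. Define $\tau:\hat\Sigma\to\Sigma$ by $\tau(\mathbf y,\mathbf x)=\tau_{\mathbf y}(\mathbf x)=(y_0,x_0,x_1,\ldots)$, and for $\mathbf x\in\Sigma$ let $\Sigma^*_{\mathbf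 x}=\{\mathbf y\in\Sigma^*:(\mathbf y,\mathbf x)\in\hat\Sigma\}$. $C^0(\cdot)$ denotes real-valued continuous functions and $C^\theta(\cdot)$ (with $\theta>0$) the $\theta$-Hölder ones. Transitive means topologically transitive: for all nonempty open $D,E\subset\Sigma$ there is $k\ge1$ with $\sigma^k(D)\cap E\neq\emptyset$. The set $\mathcal M_0$ of holonomic probabilities is the set of Borel probability measures $\hat\mu$ on $\hat\Sigma$ such that $\int f(\tau_{\mathbf y}(\mathbf x))\,d\hat\mu(\mathbf y,\mathbf x)=\int f(\mathbf x)\,d\hat\mu(\mathbf y,\mathbf x)$ for all $f\in C^0(\Sigma)$. For $A\in C^0(\hat\Sigma)$, $\beta_A=\max_{\hat\mu\in\mathcal M_0}\int_{\hat\Sigma}A\,d\hat\mu$. *)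

theory Defs
  imports "HOL-Probability.Probability"
begin

type_synonym sequence = "nat \<Rightarrow> nat"

definition sft :: "nat \<Rightarrow> (nat \<Rightarrow> nat \<Rightarrow> nat) \<Rightarrow> sequence set" where
  "sft r M = {x. (\<forall>j. x j \<in> {1..r}) \<and> (\<forall>j. M (x j) (x (Suc j)) = 1)}"

text \<open>A point \<open>(\<dots>, y\<^sub>1, y\<^sub>0)\<close> of the dual space is encoded as the function sending \<open>j\<close> to \<open>y\<^sub>j\<close>.\<close>

definition dual_sft :: "nat \<Rightarrow> (nat \<Rightarrow> nat \<Rightarrow> nat) \<Rightarrow> sequence set" where
  "dual_sft r M = {y. (\<forall>j. y j \<in> {1..r}) \<and> (\<forall>j. M (y (Suc j)) (y j) = 1)}"

definition hat_sft :: "nat \<Rightarrow> (nat \<Rightarrow> nat \<Rightarrow> nat) \<Rightarrow> (sequence \<times> sequence) set" where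
  "hat_sft r M = {(y, x). y \<in> dual_sft r M \<and> x \<in> sft r M \<and> M (y 0) (x 0) = 1}"

definition dual_fibre :: "nat \<Rightarrow> (nat \<Rightarrow> nat \<Rightarrow> nat) \<Rightarrow> sequence \<Rightarrow> sequence set" where
  "dual_fibre r M x = {y \<in> dual_sft r M. (y, x) \<in> hat_sft r M}"

definition shift :: "sequence \<Rightarrow> sequence" where
  "shift x = (\<lambda>j. x (Suc j))"

definition tau :: "sequence \<times> sequence \<Rightarrow> sequence" where
  "tau = (\<lambda>(y, x) j. case j of 0 \<Rightarrow> y 0 | Suc i \<Rightarrow> x i)"

definition seq_dist :: "real \<Rightarrow> sequence \<Rightarrow> sequence \<Rightarrow> real" where
  "seq_dist l x x' = (if x = x' then 0 else l ^ (LEAST j. x j \<noteq> x' j))"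

definition hat_dist :: "real \<Rightarrow> sequence \<times> sequence \<Rightarrow> sequence \<times> sequence \<Rightarrow> real" where
  "hat_dist l p q = max (seq_dist l (fst p) (fst q)) (seq_dist l (snd p) (snd q))"

lemma seq_dist_ultra:
  assumes "0 < l" "l < 1"
  shows "seq_dist l x z \<le> max (seq_dist l x y) (seq_dist l y z)"
proof (cases "x = y \<or> y = z \<or> x = z")
  case True
  then show ?thesis using assms by (auto simp: seq_dist_def le_max_iff_disj)
next
  case False
  define a where "a = (LEAST j. x j \<noteq> y j)"
  define b where "b = (LEAST j. y j \<noteq> z j)"
  define c where "c = (LEAST j. x j \<noteq> z j)"
  from False have "\<exists>j. x j \<noteq> z j" by auto
  then have "x c \<noteq> z c" unfolding c_def by (rule LeastI_ex)
  then have "x c \<noteq> y c \<or> y c \<noteq> z c" by auto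
  then have "a \<le> c \<or> b \<le> c" unfolding a_def b_def by (auto intro: Least_le)
  then have "l ^ c \<le> l ^ a \<or> l ^ c \<le> l ^ b"
    using assms by (auto intro: power_decreasing)
  then show ?thesis using False unfolding seq_dist_def a_def b_def c_def by auto
qed

text \<open>The topologies below are meaningful because both distances are metrics.\<close>

lemma Metric_space_seq_dist:
  assumes "0 < l" "l < 1"
  shows "Metric_space S (seq_dist l)"
proof
  show nonneg: "0 \<le> seq_dist l x y" for x y using assms by (auto simp: seq_dist_def)
  show "seq_dist l x y = seq_dist l y x" for x y
    by (auto simp: seq_dist_def eq_commute)
  show "(seq_dist l x y = 0) = (x = y)" for x y
    using assms by (auto simp: seq_dist_def)
  show "seq_dist l x z \<le> seq_dist l x y + seq_dist l y z" for x y z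
    using seq_dist_ultra[OF assms, of x z y] nonneg[of x y] nonneg[of y z] by linarith
qed

lemma Metric_space_hat_dist:
  assumes "0 < l" "l < 1"
  shows "Metric_space S (hat_dist l)"
proof -
  interpret D: Metric_space UNIV "seq_dist l" by (rule Metric_space_seq_dist[OF assms])
  show ?thesis
  proof
    show "0 \<le> hat_dist l p q" for p q by (simp add: hat_dist_def le_max_iff_disj)
    show "hat_dist l p q = hat_dist l q p" for p q by (simp add: hat_dist_def D.commute)
    show "(hat_dist l p q = 0) = (p = q)" for p q
    proof
      assume "hat_dist l p q = 0"
      then have "seq_dist l (fst p) (fst q) = 0" "seq_dist l (snd p) (snd q) = 0"
        using D.nonneg[of "fst p" "fst q"] D.nonneg[of "snd p" "snd q"]
        unfolding hat_dist_def by linarith+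
      then show "p = q" by (simp add: prod_eq_iff)
    qed (simp add: hat_dist_def)
    show "hat_dist l p s \<le> hat_dist l p q + hat_dist l q s" for p q s
      using D.triangle[of "fst p" "fst q" "fst s"] D.triangle[of "snd p" "snd q" "snd s"]
      unfolding hat_dist_def by auto
  qed
qed

definition sft_topology :: "nat \<Rightarrow> (nat \<Rightarrow> nat \<Rightarrow> nat) \<Rightarrow> real \<Rightarrow> sequence topology" where
  "sft_topology r M l = Metric_space.mtopology (sft r M) (seq_dist l)"

definition hat_topology ::
    "nat \<Rightarrow> (nat \<Rightarrow> nat \<Rightarrow> nat) \<Rightarrow> real \<Rightarrow> (sequence \<times> sequence) topology" where
  "hat_topology r M l = Metric_space.mtopology (hat_sft r M) (hat_dist l)"

definition transitive_sft :: "nat \<Rightarrow> (nat \<Rightarrow> nat \<Rightarrow> nat) \<Rightarrow> real \<Rightarrow> bool" where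
  "transitive_sft r M l \<longleftrightarrow>
     (\<forall>D E. openin (sft_topology r M l) D \<and> D \<noteq> {} \<and> openin (sft_topology r M l) E \<and> E \<noteq> {}
        \<longrightarrow> (\<exists>k\<ge>1. (shift ^^ k) ` D \<inter> E \<noteq> {}))"

definition holder_on :: "real \<Rightarrow> 'a set \<Rightarrow> ('a \<Rightarrow> 'a \<Rightarrow> real) \<Rightarrow> ('a \<Rightarrow> real) \<Rightarrow> bool" where
  "holder_on \<theta> S d f \<longleftrightarrow> (\<exists>C. \<forall>p\<in>S. \<forall>q\<in>S. \<bar>f p - f q\<bar> \<le> C * d p q powr \<theta>)"

definition holonomic ::
    "nat \<Rightarrow> (nat \<Rightarrow> nat \<Rightarrow> nat) \<Rightarrow> real \<Rightarrow> (sequence \<times> sequence) measure set" where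
  "holonomic r M l =
     {\<mu>. prob_space \<mu> \<and> space \<mu> = hat_sft r M \<and>
         sets \<mu> = sigma_sets (hat_sft r M) {U. openin (hat_topology r M l) U} \<and>
         (\<forall>f. continuous_map (sft_topology r M l) euclideanreal f \<longrightarrow>
            (\<integral>p. f (tau p) \<partial>\<mu>) = (\<integral>p. f (snd p) \<partial>\<mu>))}"

text \<open>\<open>GREATEST\<close> denotes an attained maximum, not merely a supremum.\<close>

definition beta ::
    "nat \<Rightarrow> (nat \<Rightarrow> nat \<Rightarrow> nat) \<Rightarrow> real \<Rightarrow> (sequence \<times> sequence \<Rightarrow> real) \<Rightarrow> real" where
  "beta r M l A = (GREATEST b. b \<in> (\<lambda>\<mu>. \<integral>p. A p \<partial>\<mu>) ` holonomic r M l)"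

definition is_min :: "real \<Rightarrow> real set \<Rightarrow> bool" where
  "is_min m S \<longleftrightarrow> m \<in> S \<and> (\<forall>s\<in>S. m \<le> s)"

end

theory Submission
  imports Defs
begin

text \<open>
The potential only enters through the best past of a point. A preimage \<open>z\<close> of \<open>x\<close> under the shift
is \<open>\<tau>\<^sub>y x\<close> exactly for those \<open>y\<close> with \<open>y\<^sub>0 = z\<^sub>0\<close>, and \<open>u (\<tau>\<^sub>y x) = u z\<close> for all of them. So with
\<open>B z = max {A (y, \<sigma> z). y\<^sub>0 = z\<^sub>0}\<close>, a maximum over a compact set, the equation becomes
\<open>u x = min {u z - B z. \<sigma> z = x} + c\<close>, a minimum over the finitely many preimages of \<open>x\<close>. The right side is
a min-plus transfer operator \<open>L\<close> plus a constant. Everything about \<open>u\<close> is done with \<open>L\<close> alone.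

Existence of \<open>u\<close> and \<open>c\<close>. Prepending a symbol contracts the metric by \<open>\<lambda>\<close>, so \<open>L\<close> keeps the
Hoelder constant on cylinders of length one below a fixed bound (\<open>minplus_cylinder_holder\<close>). By
transitivity, two points are joined by a prefix of uniformly bounded length, so the oscillations of the iterates
\<open>L\<^sup>n 0\<close> are uniformly bounded (\<open>minplus_iterates_oscillation\<close>). Hence \<open>n \<mapsto> L\<^sup>n 0 x\<^sub>0\<close> is additive up to
a bounded error, and therefore within a bounded distance of a linear function \<open>- n c\<close>
(\<open>minplus_bounded_iterates\<close>). The infimum \<open>v\<close> of the bounded functions \<open>L\<^sup>n 0 + n c\<close> satisfies
\<open>v \<le> L v + c\<close>, because infima commute with \<open>L\<close>; iterating \<open>L + c\<close> from \<open>v\<close> then gives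
an increasing bounded sequence, whose limit is a fixed point because a minimum over a finite set is
continuous (\<open>minplus_fixed_point_above_subsolution\<close>).

Identification \<open>c = \<beta>\<^sub>A\<close>. The fixed point equation gives \<open>A \<le> u \<circ> \<tau> - u \<circ> snd + c\<close>, with equality
at the minimising \<open>y\<close>. Integration against a holonomic probability gives \<open>\<integral>A \<le> c\<close>. For equality,
the minimising \<open>y\<close> are followed backwards from some point; along this orbit the averages of \<open>A\<close> tend to \<open>c\<close>
and those of \<open>f \<circ> \<tau> - f \<circ> snd\<close> tend to \<open>0\<close>, since both sums telescope. Any weak limit of the empirical
measures of the orbit is thus holonomic with \<open>\<integral>A = c\<close>. Such a limit is obtained from Helly's selection theorem
on the real line, into which the compact set \<open>hat_sft\<close> embeds by a digit expansion
(\<open>hat_sft_embeds_in_reals\<close>, \<open>empirical_measures_accumulate\<close>).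
\<close>

section \<open>The metric topologies are product topologies\<close>

text \<open>Cylinders form a base of the product topology on sequences. This is the bridge between
\<open>seq_dist\<close>, whose balls are cylinders, and the type class topology on functions; everything analytic
below is then done with \<open>continuous_on\<close>, \<open>compact\<close> and \<open>top_of_set\<close>.\<close>

lemma open_sequences_iff:
  fixes V :: "sequence set"
  shows "open V \<longleftrightarrow> (\<forall>x\<in>V. \<exists>n. {x'. \<forall>j\<le>n. x' j = x j} \<subseteq> V)"
proof
  assume V: "open V"
  show "\<forall>x\<in>V. \<exists>n. {x'. \<forall>j\<le>n. x' j = x j} \<subseteq> V"
  proof
    fix x assume "x \<in> V"
    with V obtain X where X: "x \<in> Pi\<^sub>E UNIV X" "finite {i. X i \<noteq> UNIV}" "Pi\<^sub>E UNIV X \<subseteq> V"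
      using product_topology_open_contains_basis[of "\<lambda>_::nat. euclidean::nat topology" UNIV V x]
      by (auto simp: open_fun_def)
    obtain n where n: "\<And>i. X i \<noteq> UNIV \<Longrightarrow> i \<le> n"
      using X(2) by (auto simp: finite_nat_set_iff_bounded_le)
    have "{x'. \<forall>j\<le>n. x' j = x j} \<subseteq> Pi\<^sub>E UNIV X"
    proof
      fix x' assume x': "x' \<in> {x'. \<forall>j\<le>n. x' j = x j}"
      have "x' i \<in> X i" for i
      proof (cases "X i = UNIV")
        case False
        then have "x' i = x i" using n x' by blast
        with X(1) show ?thesis by (metis PiE_mem UNIV_I)
      qed simp
      then show "x' \<in> Pi\<^sub>E UNIV X" by auto
    qed
    with X(3) show "\<exists>n. {x'. \<forall>j\<le>n. x' j = x j} \<subseteq> V" by blast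
  qed
next
  assume *: "\<forall>x\<in>V. \<exists>n. {x'. \<forall>j\<le>n. x' j = x j} \<subseteq> V"
  show "open V"
  proof (rule Topological_Spaces.openI)
    fix x assume "x \<in> V"
    with * obtain n where "{x'. \<forall>j\<le>n. x' j = x j} \<subseteq> V" by blast
    moreover have "open {x'. \<forall>j\<in>{..n}. x' (id j) \<in> {x j}}"
      by (rule product_topology_basis') (auto simp: Topological_Spaces.open_discrete)
    ultimately show "\<exists>T. open T \<and> x \<in> T \<and> T \<subseteq> V"
      by (intro exI[of _ "{x'. \<forall>j\<le>n. x' j = x j}"]) (auto simp: Ball_def)
  qed
qed

lemma seq_dist_less_power_iff:
  assumes "0 < l" "l < 1"
  shows "seq_dist l x x' < l ^ n \<longleftrightarrow> (\<forall>j\<le>n. x j = x' j)"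
proof (cases "x = x'")
  case True
  then show ?thesis using assms by (simp add: seq_dist_def)
next
  case False
  then have ex: "\<exists>j. x j \<noteq> x' j" by auto
  have "seq_dist l x x' < l ^ n \<longleftrightarrow> n < (LEAST j. x j \<noteq> x' j)"
    using False assms by (simp add: seq_dist_def)
  also have "\<dots> \<longleftrightarrow> (\<forall>j\<le>n. x j = x' j)"
    using LeastI_ex[OF ex] not_less_Least[of _ "\<lambda>j. x j \<noteq> x' j"] by (meson le_less_trans not_le)
  finally show ?thesis .
qed

lemma hat_dist_less_power_iff:
  assumes "0 < l" "l < 1"
  shows "hat_dist l p q < l ^ n \<longleftrightarrow> (\<forall>j\<le>n. fst p j = fst q j) \<and> (\<forall>j\<le>n. snd p j = snd q j)"
  unfolding hat_dist_def max_less_iff_conj seq_dist_less_power_iff[OF assms] ..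

text \<open>The comparison is needed for a metric on one-sided sequences and for one on pairs. Both fit
this criterion, which only asks that balls and neighbourhoods refine each other.\<close>

lemma mtopology_eq_top_of_set:
  fixes S :: "'a::topological_space set"
  assumes "Metric_space S d"
    and small: "\<And>p e. p \<in> S \<Longrightarrow> 0 < e \<Longrightarrow> \<exists>V. open V \<and> p \<in> V \<and> (\<forall>q\<in>V \<inter> S. d p q < e)"
    and large: "\<And>p V. p \<in> S \<Longrightarrow> open V \<Longrightarrow> p \<in> V \<Longrightarrow> \<exists>e>0. \<forall>q\<in>S. d p q < e \<longrightarrow> q \<in> V"
  shows "Metric_space.mtopology S d = top_of_set S"
proof (rule topology_eq[THEN iffD2], intro allI)
  interpret Metric_space S d by fact
  fix U
  show "openin mtopology U = openin (top_of_set S) U"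
  proof
    assume U: "openin mtopology U"
    then have US: "U \<subseteq> S" by (simp add: openin_mtopology)
    have "\<exists>V. open V \<and> x \<in> V \<and> V \<inter> S \<subseteq> U" if x: "x \<in> U" for x
    proof -
      have xS: "x \<in> S" using US x by (rule subsetD)
      obtain e where e: "e > 0" "mball x e \<subseteq> U" using U x by (meson openin_mtopology)
      obtain V where V: "open V" "x \<in> V" "\<forall>q\<in>V \<inter> S. d x q < e"
        using small[OF xS e(1)] by (elim exE conjE)
      have "V \<inter> S \<subseteq> mball x e" using V(3) xS by (auto simp: in_mball)
      with V(1,2) e(2) show ?thesis by (meson order_trans)
    qed
    then obtain V where V: "\<And>x. x \<in> U \<Longrightarrow> open (V x) \<and> x \<in> V x \<and> V x \<inter> S \<subseteq> U" by metis
    have "U = S \<inter> (\<Union>x\<in>U. V x)" using V US by blast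
    then show "openin (top_of_set S) U" using V by (metis openin_open open_UN)
  next
    assume "openin (top_of_set S) U"
    then obtain V where V: "open V" "U = S \<inter> V" by (auto simp: openin_open)
    show "openin mtopology U"
      unfolding openin_mtopology
    proof (intro conjI allI impI)
      fix x assume "x \<in> U"
      with V large[of x V] obtain e where "e > 0" "\<forall>q\<in>S. d x q < e \<longrightarrow> q \<in> V" by blast
      then show "\<exists>r>0. mball x r \<subseteq> U" using V by (intro exI[of _ e]) auto
    qed (use V in auto)
  qed
qed

lemma seq_dist_small:
  assumes "0 < l" "l < 1" "0 < e"
  shows "\<exists>V. open V \<and> x \<in> V \<and> (\<forall>x'\<in>V. seq_dist l x x' < e)"
proof -
  obtain n where n: "l ^ n < e" using real_arch_pow_inv[of e l] assms by auto
  let ?V = "{x'. \<forall>j\<le>n. x' j = x j}"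
  have "open ?V" by (subst open_sequences_iff) (auto intro!: exI[of _ n])
  moreover have "seq_dist l x x' < e" if "x' \<in> ?V" for x'
    using that seq_dist_less_power_iff[OF assms(1,2), of x x' n] n by auto
  ultimately show ?thesis by (intro exI[of _ ?V]) auto
qed

lemma hat_dist_small:
  assumes "0 < l" "l < 1" "0 < e"
  shows "\<exists>V. open V \<and> p \<in> V \<and> (\<forall>q\<in>V. hat_dist l p q < e)"
proof -
  obtain V W where "open V" "fst p \<in> V" "\<And>x. x \<in> V \<Longrightarrow> seq_dist l (fst p) x < e"
    and "open W" "snd p \<in> W" "\<And>x. x \<in> W \<Longrightarrow> seq_dist l (snd p) x < e"
    using seq_dist_small[OF assms, of "fst p"] seq_dist_small[OF assms, of "snd p"] by blast
  then show ?thesis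
    by (intro exI[of _ "V \<times> W"]) (auto simp: open_Times hat_dist_def mem_Times_iff)
qed

lemma sft_topology_eq:
  assumes l: "0 < l" "l < 1"
  shows "sft_topology r M l = top_of_set (sft r M)"
  unfolding sft_topology_def
proof (rule mtopology_eq_top_of_set[OF Metric_space_seq_dist[OF l]])
  show "\<exists>V. open V \<and> x \<in> V \<and> (\<forall>q\<in>V \<inter> sft r M. seq_dist l x q < e)" if "0 < e" for x e
    using seq_dist_small[OF l that, of x] by blast
  show "\<exists>e>0. \<forall>q\<in>sft r M. seq_dist l x q < e \<longrightarrow> q \<in> V" if V: "open V" "x \<in> V" for x V
  proof -
    obtain n where n: "{x'. \<forall>j\<le>n. x' j = x j} \<subseteq> V"
      using V by (auto simp: open_sequences_iff)
    have "q \<in> V" if "seq_dist l x q < l ^ n" for q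
      using n that by (auto simp: seq_dist_less_power_iff[OF l])
    then show ?thesis using l by (intro exI[of _ "l ^ n"]) auto
  qed
qed

lemma hat_topology_eq:
  assumes l: "0 < l" "l < 1"
  shows "hat_topology r M l = top_of_set (hat_sft r M)"
  unfolding hat_topology_def
proof (rule mtopology_eq_top_of_set[OF Metric_space_hat_dist[OF l]])
  show "\<exists>V. open V \<and> p \<in> V \<and> (\<forall>q\<in>V \<inter> hat_sft r M. hat_dist l p q < e)" if "0 < e" for p e
    using hat_dist_small[OF l that, of p] by blast
  show "\<exists>e>0. \<forall>q\<in>hat_sft r M. hat_dist l p q < e \<longrightarrow> q \<in> V" if V: "open V" "p \<in> V" for p V
  proof -
    obtain V1 V2 where "open V1" "open V2" "fst p \<in> V1" "snd p \<in> V2" and sub: "V1 \<times> V2 \<subseteq> V"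
      using V by (metis open_prod_elim mem_Times_iff)
    obtain m where m: "{x'. \<forall>j\<le>m. x' j = fst p j} \<subseteq> V1"
      using \<open>open V1\<close> \<open>fst p \<in> V1\<close> by (auto simp: open_sequences_iff)
    obtain n where n: "{x'. \<forall>j\<le>n. x' j = snd p j} \<subseteq> V2"
      using \<open>open V2\<close> \<open>snd p \<in> V2\<close> by (auto simp: open_sequences_iff)
    have "q \<in> V" if "hat_dist l p q < l ^ max m n" for q
    proof -
      have "fst q \<in> V1" "snd q \<in> V2"
        using m n that by (auto simp: hat_dist_less_power_iff[OF l])
      then show ?thesis using sub by (auto simp: mem_Times_iff)
    qed
    then show ?thesis using l by (intro exI[of _ "l ^ max m n"]) auto
  qed
qed

text \<open>The distances on the subshifts are not the type class distance, so the smallness of \<open>d\<close>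
near each point enters as a hypothesis.\<close>

lemma continuous_on_holder:
  fixes S :: "'a::topological_space set"
  assumes "holder_on \<theta> S d f" "0 < \<theta>"
    and nonneg: "\<And>p q. 0 \<le> d p q"
    and small: "\<And>p e. 0 < e \<Longrightarrow> \<exists>V. open V \<and> p \<in> V \<and> (\<forall>q\<in>V. d p q < e)"
  shows "continuous_on S f"
  unfolding continuous_on_topological
proof (intro ballI allI impI)
  obtain C where C: "\<And>p q. p \<in> S \<Longrightarrow> q \<in> S \<Longrightarrow> \<bar>f p - f q\<bar> \<le> C * d p q powr \<theta>"
    using assms(1) by (auto simp: holder_on_def)
  fix p B assume p: "p \<in> S" and B: "open B" "f p \<in> B"
  obtain \<epsilon> where \<epsilon>: "\<epsilon> > 0" "\<And>t. \<bar>f p - t\<bar> < \<epsilon> \<Longrightarrow> t \<in> B"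
    using B by (metis openE mem_ball dist_real_def subsetD)
  define e where "e = (\<epsilon> / (\<bar>C\<bar> + 1)) powr (1 / \<theta>)"
  have "e > 0" using \<epsilon>(1) by (auto simp: e_def)
  then obtain V where V: "open V" "p \<in> V" "\<forall>q\<in>V. d p q < e" using small by blast
  have "f q \<in> B" if q: "q \<in> S" "q \<in> V" for q
  proof (rule \<epsilon>(2))
    have "d p q powr \<theta> \<le> e powr \<theta>" using V q nonneg assms(2) by (intro powr_mono2) (auto intro: less_imp_le)
    also have "\<dots> = \<epsilon> / (\<bar>C\<bar> + 1)" using \<epsilon>(1) assms(2) by (simp add: e_def powr_powr)
    finally have "\<bar>C\<bar> * d p q powr \<theta> \<le> \<bar>C\<bar> * (\<epsilon> / (\<bar>C\<bar> + 1))" by (intro mult_left_mono) auto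
    also have "\<dots> < \<epsilon>" using \<epsilon>(1) by (simp add: field_simps)
    finally have "\<bar>C\<bar> * d p q powr \<theta> < \<epsilon>" .
    moreover have "C * d p q powr \<theta> \<le> \<bar>C\<bar> * d p q powr \<theta>" by (intro mult_right_mono) auto
    ultimately show "\<bar>f p - f q\<bar> < \<epsilon>" using C[OF p q(1)] by linarith
  qed
  then show "\<exists>A. open A \<and> p \<in> A \<and> (\<forall>q\<in>S. q \<in> A \<longrightarrow> f q \<in> B)" using V by blast
qed

lemma compact_bounded_sequences: "compact {x::sequence. \<forall>j. x j \<in> {1..r}}"
proof -
  have "compactin (product_topology (\<lambda>_::nat. euclidean::nat topology) UNIV) (Pi\<^sub>E UNIV (\<lambda>_. {1..r}))"
    by (subst compactin_PiE) (auto simp: finite_imp_compact)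
  then have "compact (Pi\<^sub>E UNIV (\<lambda>_::nat. {1..r}))"
    by (simp add: euclidean_product_topology)
  moreover have "Pi\<^sub>E UNIV (\<lambda>_::nat. {1..r}) = {x::sequence. \<forall>j. x j \<in> {1..r}}"
    by (auto simp: PiE_iff)
  ultimately show ?thesis by simp
qed

text \<open>Every relation between two letters is clopen because the alphabet is discrete; the
subshifts are intersections of such constraints.\<close>

lemma closed_coordinates_constraint:
  fixes f g :: "'a::topological_space \<Rightarrow> nat"
  assumes "continuous_on UNIV f" "continuous_on UNIV g"
  shows "closed {p. P (f p) (g p)}"
proof -
  have "open (f -` {a} \<inter> g -` {b})" for a b
    using assms by (intro open_Int open_vimage) (auto simp: Topological_Spaces.open_discrete)
  then have "open (\<Union>(a, b)\<in>{(a, b). \<not> P a b}. f -` {a} \<inter> g -` {b})" by auto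
  also have "(\<Union>(a, b)\<in>{(a, b). \<not> P a b}. f -` {a} \<inter> g -` {b}) = - {p. P (f p) (g p)}" by auto
  finally show ?thesis by (simp add: closed_def)
qed

lemma continuous_on_coordinate [continuous_intros]:
  fixes f :: "'a::topological_space \<Rightarrow> sequence"
  assumes "continuous_on S f"
  shows "continuous_on S (\<lambda>p. f p i)"
  using continuous_on_product_then_coordinatewise[OF assms] .

lemma compact_hat_sft: "compact (hat_sft r M)"
proof -
  let ?K = "{x::sequence. \<forall>j. x j \<in> {1..r}}"
  have "compact (?K \<times> ?K)" by (intro compact_Times compact_bounded_sequences)
  moreover have "closed ((\<Inter>j. {p. M (fst p (Suc j)) (fst p j) = 1}) \<inter>
      (\<Inter>j. {p. M (snd p j) (snd p (Suc j)) = 1}) \<inter> {p. M (fst p 0) (snd p 0) = 1})"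
    by (intro closed_Int closed_INT ballI closed_coordinates_constraint[where P = "\<lambda>a b. M a b = 1"]
        continuous_intros)
  ultimately have "compact ((?K \<times> ?K) \<inter> ((\<Inter>j. {p. M (fst p (Suc j)) (fst p j) = 1}) \<inter>
      (\<Inter>j. {p. M (snd p j) (snd p (Suc j)) = 1}) \<inter> {p. M (fst p 0) (snd p 0) = 1}))"
    by (rule compact_Int_closed)
  also have "\<dots> = hat_sft r M"
    by (auto simp: hat_sft_def sft_def dual_sft_def)
  finally show ?thesis .
qed

lemma continuous_on_tau: "continuous_on S tau"
proof (rule continuous_on_coordinatewise_then_product)
  fix i show "continuous_on S (\<lambda>p. tau p i)"
    by (cases i) (simp_all add: tau_def case_prod_beta continuous_on_coordinate continuous_on_fst continuous_on_snd)
qed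

section \<open>Embedding the natural extension into the real line\<close>

text \<open>Base \<open>r + 2\<close> leaves a gap for digits at most \<open>r\<close>: the tail after the first digit is less
than one, so no two expansions coincide and \<open>floor\<close> reads off the first digit.\<close>

definition digit_expansion :: "nat \<Rightarrow> sequence \<Rightarrow> real" where
  "digit_expansion r x = (\<Sum>n. real (x n) * (1 / (real r + 2)) ^ n)"

lemma digit_expansion_bounds:
  assumes "\<And>j. x j \<le> r"
  shows "summable (\<lambda>n. real (x n) * (1 / (real r + 2)) ^ n)"
    and "0 \<le> digit_expansion r x" and "digit_expansion r x < real r + 2"
proof -
  let ?q = "1 / (real r + 2)"
  have g: "(\<lambda>n. real r * ?q ^ n) sums (real r * (1 / (1 - ?q)))"
    by (intro sums_mult geometric_sums) auto
  show s: "summable (\<lambda>n. real (x n) * ?q ^ n)"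
    by (rule summable_comparison_test'[OF sums_summable[OF g], of 0])
      (auto intro!: mult_right_mono divide_right_mono simp: assms)
  show "0 \<le> digit_expansion r x" unfolding digit_expansion_def by (intro suminf_nonneg s) auto
  have "digit_expansion r x \<le> real r * (1 / (1 - ?q))"
    unfolding digit_expansion_def sums_unique[OF g]
    by (intro suminf_le s sums_summable[OF g] mult_right_mono) (auto simp: assms)
  also have "\<dots> < real r + 2" by (simp add: field_simps)
  finally show "digit_expansion r x < real r + 2" .
qed

lemma digit_expansion_rec:
  assumes "\<And>j. x j \<le> r"
  shows "digit_expansion r x = real (x 0) + digit_expansion r (shift x) / (real r + 2)"
proof -
  let ?q = "1 / (real r + 2)"
  have "digit_expansion r x = real (x 0) + (\<Sum>n. ?q * (real (x (Suc n)) * ?q ^ n))"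
    unfolding digit_expansion_def
    using suminf_split_head[OF digit_expansion_bounds(1)[of x r]] assms by (simp add: mult_ac)
  also have "(\<Sum>n. ?q * (real (x (Suc n)) * ?q ^ n)) = ?q * digit_expansion r (shift x)"
    unfolding digit_expansion_def
    using suminf_mult[OF digit_expansion_bounds(1)[of "shift x" r], of ?q] assms
    by (simp add: shift_def)
  finally show ?thesis by simp
qed

lemma inj_on_digit_expansion: "inj_on (digit_expansion r) {x. \<forall>j. x j \<le> r}"
proof (rule inj_onI)
  have head: "x 0 = x' 0 \<and> digit_expansion r (shift x) = digit_expansion r (shift x')"
    if "\<And>j. x j \<le> r" "\<And>j. x' j \<le> r" "digit_expansion r x = digit_expansion r x'" for x x'
  proof -
    have "\<lfloor>digit_expansion r z\<rfloor> = int (z 0)" if "\<And>j. z j \<le> r" for z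
    proof -
      have "0 \<le> digit_expansion r (shift z) / (real r + 2)" "digit_expansion r (shift z) / (real r + 2) < 1"
        using digit_expansion_bounds(2,3)[of "shift z" r] that by (auto simp: shift_def)
      then show ?thesis using digit_expansion_rec[of z r] that by (intro floor_unique) auto
    qed
    then have "x 0 = x' 0" using that by (metis of_nat_eq_iff)
    then show ?thesis using that digit_expansion_rec[of x r] digit_expansion_rec[of x' r] by simp
  qed
  have "\<forall>x x'. (\<forall>j. x j \<le> r) \<longrightarrow> (\<forall>j. x' j \<le> r) \<longrightarrow> digit_expansion r x = digit_expansion r x' \<longrightarrow> x n = x' n" for n
  proof (induction n)
    case 0
    then show ?case using head by blast
  next
    case (Suc n)
    show ?case
    proof (intro allI impI)
      fix x x' assume *: "\<forall>j. x j \<le> r" "\<forall>j. x' j \<le> r" "digit_expansion r x = digit_expansion r x'"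
      then have "\<forall>j. shift x j \<le> r" "\<forall>j. shift x' j \<le> r"
        "digit_expansion r (shift x) = digit_expansion r (shift x')"
        using head[of x x'] by (auto simp: shift_def)
      with Suc have "shift x n = shift x' n" by blast
      then show "x (Suc n) = x' (Suc n)" by (simp add: shift_def)
    qed
  qed
  then show "x = x'" if "x \<in> {x. \<forall>j. x j \<le> r}" "x' \<in> {x. \<forall>j. x j \<le> r}"
    "digit_expansion r x = digit_expansion r x'" for x x'
    using that by auto
qed

lemma continuous_on_digit_expansion: "continuous_on {x. \<forall>j. x j \<le> r} (digit_expansion r)"
proof -
  let ?q = "1 / (real r + 2)"
  have A: "uniform_limit {x. \<forall>j. x j \<le> r} (\<lambda>n x. \<Sum>i<n. real (x i) * ?q ^ i) (digit_expansion r) sequentially"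
    unfolding digit_expansion_def[abs_def]
    by (rule Weierstrass_m_test[where M = "\<lambda>n. real r * ?q ^ n"])
      (auto intro!: mult_right_mono divide_right_mono summable_mult summable_geometric)
  have B: "continuous_on {x. \<forall>j. x j \<le> r} (\<lambda>x. \<Sum>i<n. real (x i) * ?q ^ i)" for n
    by (intro continuous_on_sum continuous_on_mult continuous_on_const
        continuous_on_compose2[OF Topological_Spaces.continuous_on_discrete[of UNIV real] continuous_on_coordinate]
        continuous_on_id) auto
  show ?thesis by (rule uniform_limit_theorem[OF always_eventually[OF allI[OF B]] A]) simp
qed

definition interleave :: "sequence \<times> sequence \<Rightarrow> sequence" where
  "interleave p n = (if even n then fst p (n div 2) else snd p (n div 2))"

lemma inj_interleave: "inj interleave"
proof (rule injI)
  fix p q assume *: "interleave p = interleave q"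
  have "fst p n = fst q n" for n using fun_cong[OF *, of "2 * n"] by (simp add: interleave_def)
  moreover have "snd p n = snd q n" for n using fun_cong[OF *, of "Suc (2 * n)"] by (simp add: interleave_def)
  ultimately show "p = q" by (auto simp: prod_eq_iff)
qed

lemma hat_sft_embeds_in_reals:
  obtains \<phi> :: "sequence \<times> sequence \<Rightarrow> real"
  where "continuous_on (hat_sft r M) \<phi>" "inj_on \<phi> (hat_sft r M)"
proof
  have sub: "interleave ` hat_sft r M \<subseteq> {x. \<forall>j. x j \<le> r}"
    by (auto simp: hat_sft_def sft_def dual_sft_def interleave_def)
  have "continuous_on (hat_sft r M) interleave"
  proof (rule continuous_on_coordinatewise_then_product)
    show "continuous_on (hat_sft r M) (\<lambda>p. interleave p n)" for n
      by (cases "even n") (simp_all add: interleave_def continuous_on_coordinate continuous_on_fst continuous_on_snd)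
  qed
  then show "continuous_on (hat_sft r M) (digit_expansion r \<circ> interleave)"
    by (rule continuous_on_compose[OF _ continuous_on_subset[OF continuous_on_digit_expansion sub]])
  show "inj_on (digit_expansion r \<circ> interleave) (hat_sft r M)"
    by (rule comp_inj_on[OF inj_on_subset[OF inj_interleave subset_UNIV]
          inj_on_subset[OF inj_on_digit_expansion sub]])
qed

section \<open>Accumulation points of empirical measures\<close>

text \<open>The \<open>\<sigma>\<close>-algebra has the form it has in \<open>holonomic\<close>, generated by the relatively open
subsets, so that holonomic measures need no translation.\<close>

lemma borel_measurable_of_continuous_on:
  fixes f :: "'a::topological_space \<Rightarrow> 'b::topological_space"
  assumes "continuous_on X f" "space \<mu> = X" "sets \<mu> = sigma_sets X {U. openin (top_of_set X) U}"
  shows "f \<in> borel_measurable \<mu>"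
proof (rule borel_measurableI)
  fix V :: "'b set" assume "open V"
  then have "openin (top_of_set X) (X \<inter> f -` V)"
    using assms(1) by (simp add: continuous_openin_preimage_gen)
  then show "f -` V \<inter> space \<mu> \<in> sets \<mu>" using assms by (auto simp: Int_commute)
qed

text \<open>Weak sequential compactness for a compact space that embeds into the line. The images of the
empirical measures live on the compact set \<open>\<phi> ` X\<close>, so they are tight and Helly's theorem applies. Test functions
are transported by Tietze extension; testing with the distance to \<open>\<phi> ` X\<close> shows that the limit is carried by
this set, so that it can be pulled back to \<open>X\<close>.\<close>

lemma empirical_measures_accumulate:
  fixes X :: "'a::topological_space set" and \<phi> :: "'a \<Rightarrow> real" and p :: "nat \<Rightarrow> 'a"
  assumes X: "compact X" and \<phi>: "continuous_on X \<phi>" "inj_on \<phi> X" and p: "\<And>n. p n \<in> X"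
  obtains \<mu> s where "strict_mono s" "prob_space \<mu>" "space \<mu> = X"
    "sets \<mu> = sigma_sets X {U. openin (top_of_set X) U}"
    "\<forall>f :: 'a \<Rightarrow> real. continuous_on X f \<longrightarrow>
       (\<lambda>n. (\<Sum>i\<le>s n. f (p i)) / real (Suc (s n))) \<longlonglongrightarrow> (\<integral>x. f x \<partial>\<mu>)"
proof -
  define K where "K = \<phi> ` X"
  define \<psi> where "\<psi> = inv_into X \<phi>"
  have \<psi>: "\<psi> (\<phi> x) = x" if "x \<in> X" for x using that \<phi>(2) by (simp add: \<psi>_def)
  have \<psi>X: "\<psi> t \<in> X" if "t \<in> K" for t using that \<psi> by (auto simp: K_def)
  have cK: "compact K" unfolding K_def using \<phi>(1) X by (rule compact_continuous_image)
  have cont_\<psi>: "continuous_on K \<psi>"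
    unfolding K_def using \<phi>(1) X \<psi> by (intro continuous_on_inv) auto
  have pK: "\<phi> (p n) \<in> K" for n using p by (auto simp: K_def)
  define \<nu> where "\<nu> n = distr (measure_pmf (pmf_of_set {..n})) borel (\<phi> \<circ> p)" for n :: nat
  have \<nu>_dist: "real_distribution (\<nu> n)" for n
    unfolding \<nu>_def by (rule prob_space.real_distribution_distr[OF measure_pmf.prob_space_axioms]) simp
  have int_\<nu>: "(\<integral>t. g t \<partial>\<nu> n) = (\<Sum>i\<le>n. g (\<phi> (p i))) / real (Suc n)"
    if "g \<in> borel_measurable borel" for g :: "real \<Rightarrow> real" and n
    unfolding \<nu>_def using that by (subst integral_distr) (auto simp: integral_pmf_of_set)
  obtain B where B: "\<And>t. t \<in> K \<Longrightarrow> \<bar>t\<bar> \<le> B"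
    using compact_imp_bounded[OF cK] by (auto simp: bounded_iff)
  have "tight \<nu>"
    unfolding tight_def
  proof (intro conjI allI impI)
    show "real_distribution (\<nu> n)" for n by (rule \<nu>_dist)
    fix e :: real assume "0 < e"
    have "measure (\<nu> n) {- B - 1<..B} = 1" for n
    proof -
      have in_iv: "- B - 1 < t \<and> t \<le> B" if "t \<in> K" for t
        using B[OF that] unfolding abs_le_iff by linarith
      then have "(\<phi> \<circ> p) -` {- B - 1<..B} = UNIV" using pK by auto
      then show ?thesis unfolding \<nu>_def by (subst measure_distr) auto
    qed
    moreover have "- B - 1 < B" using B[OF pK[of 0]] by linarith
    ultimately show "\<exists>a b. a < b \<and> (\<forall>n. 1 - e < measure (\<nu> n) {a<..b})"
      using \<open>0 < e\<close> by (intro exI[of _ "- B - 1"] exI[of _ B]) auto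
  qed
  then obtain s N where s: "strict_mono s" and N: "real_distribution N" and conv: "weak_conv_m (\<nu> \<circ> id \<circ> s) N"
    using tight_imp_convergent_subsubsequence[of \<nu> id] by (auto simp: strict_mono_id)
  interpret N: real_distribution N by fact
  have lim: "(\<lambda>n. (\<Sum>i\<le>s n. g (\<phi> (p i))) / real (Suc (s n))) \<longlonglongrightarrow> (\<integral>t. g t \<partial>N)"
    if g: "continuous_on UNIV g" "\<And>t. \<bar>g t\<bar> \<le> b" for g :: "real \<Rightarrow> real" and b
  proof -
    have "(\<lambda>n. \<integral>t. g t \<partial>((\<nu> \<circ> id \<circ> s) n)) \<longlonglongrightarrow> (\<integral>t. g t \<partial>N)"
      by (rule weak_conv_imp_integral_bdd_continuous_conv[OF _ N conv, of g b])
        (use g \<nu>_dist in \<open>auto simp: continuous_on_eq_continuous_at\<close>)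
    then show ?thesis using g(1) by (simp add: int_\<nu> borel_measurable_continuous_onI)
  qed
  have closedK: "closed K" using cK by (rule compact_imp_closed)
  have AE_K: "AE t in N. t \<in> K"
  proof -
    define h where "h t = min 1 (infdist t K)" for t
    have h: "continuous_on UNIV h" unfolding h_def by (intro continuous_intros)
    have "\<bar>h t\<bar> \<le> 1" for t by (auto simp: h_def infdist_nonneg)
    from lim[OF h this] have "(\<integral>t. h t \<partial>N) = 0"
      using pK by (simp add: h_def LIMSEQ_const_iff)
    moreover have "integrable N h"
      using h by (intro N.integrable_const_bound[of _ 1]) (auto simp: h_def infdist_nonneg borel_measurable_continuous_onI)
    moreover have "AE t in N. 0 \<le> h t" by (auto simp: h_def infdist_nonneg)
    ultimately have "AE t in N. h t = 0" by (simp add: integral_nonneg_eq_0_iff_AE)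
    moreover have "t \<in> K" if "h t = 0" for t
    proof -
      have "infdist t K = 0" using that by (auto simp: h_def min_def split: if_splits)
      then show ?thesis using in_closed_iff_infdist_zero[OF closedK] pK by blast
    qed
    ultimately show ?thesis by (auto elim: eventually_mono)
  qed
  \<comment> \<open>The complement of \<open>K\<close> is null for the limit, so any value in \<open>X\<close> will do there.\<close>
  define \<psi>' where "\<psi>' t = (if t \<in> K then \<psi> t else p 0)" for t
  let ?BX = "sigma X {U. openin (top_of_set X) U}"
  have sub: "{U. openin (top_of_set X) U} \<subseteq> Pow X" by (auto dest: openin_imp_subset)
  have spaceBX: "space ?BX = X" and setsBX: "sets ?BX = sigma_sets X {U. openin (top_of_set X) U}"
    using sub by (auto simp: space_measure_of sets_measure_of)
  have \<psi>'_meas: "\<psi>' \<in> measurable N ?BX"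
  proof (rule measurable_measure_of[OF sub])
    show "\<psi>' \<in> space N \<rightarrow> X" using \<psi>X p by (auto simp: \<psi>'_def)
    fix U assume "U \<in> {U. openin (top_of_set X) U}"
    then have "openin (top_of_set K) (K \<inter> \<psi> -` U)"
      using cont_\<psi> \<psi>X by (intro continuous_openin_preimage[of K \<psi> X]) auto
    then have "K \<inter> \<psi> -` U \<in> sets borel"
      using closedK by (auto simp: openin_open)
    moreover have "\<psi>' -` U \<inter> space N = (K \<inter> \<psi> -` U) \<union> (if p 0 \<in> U then - K else {})"
      by (auto simp: \<psi>'_def split: if_splits)
    ultimately show "\<psi>' -` U \<inter> space N \<in> sets N"
      using closedK by auto
  qed
  define \<mu> where "\<mu> = distr N ?BX \<psi>'"
  show thesis
  proof (rule that)
    show "strict_mono s" by (rule s)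
    show "prob_space \<mu>" unfolding \<mu>_def using \<psi>'_meas by (rule N.prob_space_distr)
    show sp: "space \<mu> = X" by (simp add: \<mu>_def spaceBX)
    show st: "sets \<mu> = sigma_sets X {U. openin (top_of_set X) U}" by (simp add: \<mu>_def setsBX)
    show "\<forall>f :: 'a \<Rightarrow> real. continuous_on X f \<longrightarrow>
      (\<lambda>n. (\<Sum>i\<le>s n. f (p i)) / real (Suc (s n))) \<longlonglongrightarrow> (\<integral>x. f x \<partial>\<mu>)"
    proof (intro allI impI)
      fix f :: "'a \<Rightarrow> real" assume f: "continuous_on X f"
      have f\<psi>: "continuous_on K (f \<circ> \<psi>)"
        using cont_\<psi> f \<psi>X by (intro continuous_on_compose) (auto elim: continuous_on_subset)
      obtain b where b: "\<And>x. x \<in> X \<Longrightarrow> norm (f x) \<le> b"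
        using compact_imp_bounded[OF compact_continuous_image[OF f X]] by (auto simp: bounded_iff)
      have "0 \<le> b" using b[OF p[of 0]] norm_ge_zero order_trans by blast
      obtain g where g: "continuous_on UNIV g" "\<And>t. t \<in> K \<Longrightarrow> g t = (f \<circ> \<psi>) t" "\<And>t. norm (g t) \<le> b"
      proof (rule Tietze[OF f\<psi> _ \<open>0 \<le> b\<close>, of UNIV])
        show "closedin (top_of_set UNIV) K" using closedK by simp
        show "norm ((f \<circ> \<psi>) t) \<le> b" if "t \<in> K" for t using b \<psi>X[OF that] by simp
      qed auto
      have "f \<in> borel_measurable ?BX"
        using f spaceBX setsBX by (rule borel_measurable_of_continuous_on)
      then have "(\<integral>x. f x \<partial>\<mu>) = (\<integral>t. f (\<psi>' t) \<partial>N)"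
        unfolding \<mu>_def using \<psi>'_meas by (subst integral_distr) auto
      also have "\<dots> = (\<integral>t. g t \<partial>N)"
      proof (rule integral_cong_AE)
        show "(\<lambda>t. f (\<psi>' t)) \<in> borel_measurable N"
          using \<psi>'_meas \<open>f \<in> borel_measurable ?BX\<close> by (rule measurable_compose)
        show "g \<in> borel_measurable N" using g(1) by (simp add: borel_measurable_continuous_onI)
        show "AE t in N. f (\<psi>' t) = g t" using AE_K by eventually_elim (simp add: g(2) \<psi>'_def)
      qed
      finally show "(\<lambda>n. (\<Sum>i\<le>s n. f (p i)) / real (Suc (s n))) \<longlonglongrightarrow> (\<integral>x. f x \<partial>\<mu>)"
        using lim[of g b] g pK \<psi> p by simp
    qed
  qed
qed

lemma bounded_increment_average_tendsto_0:
  fixes g :: "nat \<Rightarrow> real"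
  assumes "\<And>n. \<bar>g n\<bar> \<le> b" "strict_mono s"
  shows "(\<lambda>n. (g (Suc (s n)) - g 0) / real (Suc (s n))) \<longlonglongrightarrow> 0"
proof -
  have "(\<lambda>n. 2 * b * inverse (real (Suc n))) \<longlonglongrightarrow> 2 * b * 0"
    by (intro tendsto_mult tendsto_const LIMSEQ_inverse_real_of_nat)
  from LIMSEQ_subseq_LIMSEQ[OF this assms(2)]
  have null: "(\<lambda>n. 2 * b * inverse (real (Suc (s n)))) \<longlonglongrightarrow> 0" by (simp add: o_def)
  have bound: "norm ((g (Suc (s n)) - g 0) / real (Suc (s n))) \<le> 2 * b * inverse (real (Suc (s n)))" for n
  proof -
    have "\<bar>g (Suc (s n)) - g 0\<bar> \<le> 2 * b" using assms(1)[of "Suc (s n)"] assms(1)[of 0] by linarith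
    then have "\<bar>g (Suc (s n)) - g 0\<bar> / real (Suc (s n)) \<le> 2 * b / real (Suc (s n))"
      by (intro divide_right_mono) auto
    then show ?thesis by (simp add: divide_inverse[of "2 * b"] del: of_nat_Suc)
  qed
  show ?thesis by (rule Lim_null_comparison[OF always_eventually[OF allI[OF bound]] null])
qed

section \<open>Almost additive sequences\<close>

text \<open>Comparing \<open>s (m * n)\<close> with both \<open>m * s n\<close> and \<open>n * s m\<close> shows that
every \<open>(s n - Q) / n\<close> lies below every \<open>(s m + Q) / m\<close>; any number in between is a slope.\<close>

lemma quasi_additive_imp_near_linear:
  fixes s :: "nat \<Rightarrow> real"
  assumes Q: "\<And>m n. \<bar>s (m + n) - s m - s n\<bar> \<le> Q"
  obtains c where "\<And>n. \<bar>s n - real n * c\<bar> \<le> Q"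
proof -
  have s0: "\<bar>s 0\<bar> \<le> Q" using Q[of 0 0] by simp
  then have Q0: "0 \<le> Q" by linarith
  have mult: "\<bar>s (Suc m * n) - real (Suc m) * s n\<bar> \<le> real m * Q" for m n
  proof (induction m)
    case (Suc m)
    have "s (Suc (Suc m) * n) - real (Suc (Suc m)) * s n =
        (s (n + Suc m * n) - s n - s (Suc m * n)) + (s (Suc m * n) - real (Suc m) * s n)"
      by (simp add: algebra_simps)
    moreover have "real (Suc m) * Q = Q + real m * Q" by (simp add: algebra_simps)
    ultimately show ?case using Suc Q[of n "Suc m * n"] by linarith
  qed simp
  have cross: "(s n - Q) / n \<le> (s m + Q) / m" if "0 < m" "0 < n" for m n
  proof -
    have "\<bar>s (m * n) - real m * s n\<bar> \<le> real m * Q"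
    proof -
      obtain m' where m': "m = Suc m'" using \<open>0 < m\<close> by (cases m) auto
      have "real m' * Q \<le> real (Suc m') * Q" using Q0 by (intro mult_right_mono) auto
      then show ?thesis unfolding m' using mult[of m' n] by linarith
    qed
    moreover have "\<bar>s (m * n) - real n * s m\<bar> \<le> real n * Q"
    proof -
      obtain n' where n': "n = Suc n'" using \<open>0 < n\<close> by (cases n) auto
      have "real n' * Q \<le> real (Suc n') * Q" using Q0 by (intro mult_right_mono) auto
      then show ?thesis unfolding n' mult.commute[of m] using mult[of n' m] by linarith
    qed
    ultimately have "real m * s n - real m * Q \<le> real n * s m + real n * Q" by linarith
    then show ?thesis using that by (simp add: field_simps)
  qed
  define c where "c = (SUP n\<in>{0<..}. (s n - Q) / real n)"
  have lower: "(s n - Q) / n \<le> c" if "0 < n" for n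
    unfolding c_def using that cross[of 1] by (intro cSUP_upper bdd_aboveI2) auto
  have upper: "c \<le> (s m + Q) / m" if "0 < m" for m
    unfolding c_def using that cross by (intro cSUP_least) auto
  have "\<bar>s n - real n * c\<bar> \<le> Q" for n
  proof (cases "n = 0")
    case False
    then have "s n - Q \<le> real n * c" "real n * c \<le> s n + Q"
      using lower[of n] upper[of n] by (auto simp: field_simps)
    then show ?thesis by linarith
  qed (use s0 in simp)
  then show thesis using that by blast
qed

section \<open>Shift, prefixes and the metric\<close>

lemma shift_funpow: "(shift ^^ k) x = (\<lambda>j. x (j + k))"
  by (induction k) (auto simp: shift_def)

lemma shift_in_sft: "x \<in> sft r M \<Longrightarrow> shift x \<in> sft r M"
  by (auto simp: sft_def shift_def)

lemma shift_funpow_in_sft: "x \<in> sft r M \<Longrightarrow> (shift ^^ k) x \<in> sft r M"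
  by (induction k) (auto simp: shift_in_sft)

lemma seq_dist_nonneg: "0 < l \<Longrightarrow> 0 \<le> seq_dist l x x'"
  by (simp add: seq_dist_def)

lemma seq_dist_le_1: "0 < l \<Longrightarrow> l < 1 \<Longrightarrow> seq_dist l x x' \<le> 1"
  by (simp add: seq_dist_def power_le_one)

lemma seq_dist_commute: "seq_dist l x x' = seq_dist l x' x"
  by (auto simp: seq_dist_def eq_commute)

lemma seq_dist_different_head: "x 0 \<noteq> x' 0 \<Longrightarrow> seq_dist l x x' = 1"
proof -
  assume ne: "x 0 \<noteq> x' 0"
  then have "(LEAST j. x j \<noteq> x' j) = 0" by (intro Least_eq_0) simp
  then show ?thesis using ne by (auto simp: seq_dist_def)
qed

text \<open>The contraction on which all Hoelder estimates rest.\<close>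

lemma seq_dist_same_head:
  assumes "x 0 = x' 0"
  shows "seq_dist l x x' = l * seq_dist l (shift x) (shift x')"
proof (cases "x = x'")
  case False
  then obtain i where i: "x i \<noteq> x' i" by auto
  have "(LEAST j. x j \<noteq> x' j) = Suc (LEAST j. x (Suc j) \<noteq> x' (Suc j))"
    using i assms by (intro Least_Suc) auto
  moreover have "shift x \<noteq> shift x'"
  proof
    assume "shift x = shift x'"
    then have "x (Suc j) = x' (Suc j)" for j by (auto simp: shift_def dest: fun_cong)
    with i assms show False by (cases i) auto
  qed
  ultimately show ?thesis using False by (simp add: seq_dist_def shift_def)
qed (simp add: seq_dist_def)

section \<open>The min-plus transfer operator\<close>

definition preimages :: "nat \<Rightarrow> (nat \<Rightarrow> nat \<Rightarrow> nat) \<Rightarrow> sequence \<Rightarrow> sequence set" where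
  "preimages r M x = {z \<in> sft r M. shift z = x}"

lemma finite_preimages: "finite (preimages r M x)"
proof (rule finite_subset)
  show "preimages r M x \<subseteq> (\<lambda>a. case_nat a x) ` {1..r}"
  proof
    fix z assume "z \<in> preimages r M x"
    then have "z = case_nat (z 0) x" "z 0 \<in> {1..r}"
      by (auto simp: preimages_def sft_def shift_def fun_eq_iff split: nat.split)
    then show "z \<in> (\<lambda>a. case_nat a x) ` {1..r}" by blast
  qed
qed simp

text \<open>A Lax-Oleinik operator: the transfer operator of the shift with weight \<open>B\<close> in the
min-plus semiring. It is the operator \<open>L\<close> of the comments.\<close>

definition minplus ::
    "nat \<Rightarrow> (nat \<Rightarrow> nat \<Rightarrow> nat) \<Rightarrow> (sequence \<Rightarrow> real) \<Rightarrow> (sequence \<Rightarrow> real) \<Rightarrow> sequence \<Rightarrow> real" where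
  "minplus r M B u x = Min ((\<lambda>z. u z - B z) ` preimages r M x)"

text \<open>Hoelder continuity restricted to pairs with a common first letter. Two points have the
same admissible pasts when their first letters agree, so this is the form of regularity that the
transfer operator preserves, with a constant independent of the number of iterations.\<close>

definition cylinder_holder ::
    "nat \<Rightarrow> (nat \<Rightarrow> nat \<Rightarrow> nat) \<Rightarrow> real \<Rightarrow> real \<Rightarrow> real \<Rightarrow> (sequence \<Rightarrow> real) \<Rightarrow> bool" where
  "cylinder_holder r M l \<theta> H u \<longleftrightarrow> (\<forall>x\<in>sft r M. \<forall>x'\<in>sft r M. x 0 = x' 0 \<longrightarrow>
     \<bar>u x - u x'\<bar> \<le> H * seq_dist l x x' powr \<theta>)"

lemma minplus_le: "z \<in> sft r M \<Longrightarrow> minplus r M B u (shift z) \<le> u z - B z"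
  unfolding minplus_def
  by (intro Min_le finite_imageI finite_preimages imageI) (auto simp: preimages_def)

locale transitive_subshift =
  fixes r :: nat and M :: "nat \<Rightarrow> nat \<Rightarrow> nat" and l :: real
  assumes l: "0 < l" "l < 1" and nonempty: "sft r M \<noteq> {}" and transitive: "transitive_sft r M l"
begin

lemma openin_cylinder: "openin (sft_topology r M l) {x \<in> sft r M. x 0 = a}"
proof -
  have "open {x::sequence. x 0 = a}" by (subst open_sequences_iff) (auto intro!: exI[of _ 0])
  then show ?thesis
    by (auto simp: sft_topology_eq[OF l] openin_open intro!: exI[of _ "{x. x 0 = a}"])
qed

text \<open>The number \<open>k\<close> depends only on the first letters: the word found by transitivity between the
two cylinders can be placed in front of any point of the second one.\<close>

lemma connecting_word:
  assumes "w \<in> sft r M" "w' \<in> sft r M"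
  shows "\<exists>k\<ge>1. \<forall>x\<in>sft r M. x 0 = w' 0 \<longrightarrow> (\<exists>z\<in>sft r M. z 0 = w 0 \<and> (shift ^^ k) z = x)"
proof -
  let ?D = "\<lambda>a. {x \<in> sft r M. x 0 = a}"
  have "\<exists>k\<ge>1. (shift ^^ k) ` ?D (w 0) \<inter> ?D (w' 0) \<noteq> {}"
    using transitive assms openin_cylinder unfolding transitive_sft_def by blast
  then obtain k v where k: "1 \<le> k" and v: "v \<in> sft r M" "v 0 = w 0" "v k = w' 0"
    by (auto simp: shift_funpow)
  have "\<exists>z\<in>sft r M. z 0 = w 0 \<and> (shift ^^ k) z = x" if x: "x \<in> sft r M" "x 0 = w' 0" for x
  proof
    define z where "z j = (if j < k then v j else x (j - k))" for j
    show "z 0 = w 0 \<and> (shift ^^ k) z = x" using k v by (auto simp: z_def shift_funpow)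
    have "M (z j) (z (Suc j)) = 1" for j
    proof (cases "Suc j" k rule: linorder_cases)
      case less
      then show ?thesis using v by (simp add: z_def sft_def)
    next
      case equal
      then have "z j = v j" "z (Suc j) = v (Suc j)" using v x by (auto simp: z_def)
      then show ?thesis using v by (simp add: sft_def)
    next
      case greater
      then have "z (Suc j) = x (Suc (j - k))" by (simp add: z_def Suc_diff_le)
      with greater show ?thesis using x by (simp add: z_def sft_def)
    qed
    moreover have "z j \<in> {1..r}" for j using v x by (simp add: z_def sft_def)
    ultimately show "z \<in> sft r M" by (simp add: sft_def)
  qed
  with k show ?thesis by blast
qed

lemma uniform_connecting_time:
  "\<exists>K. \<forall>x\<in>sft r M. \<forall>x'\<in>sft r M. \<exists>k\<le>K. \<exists>z\<in>sft r M. z 0 = x' 0 \<and> (shift ^^ k) z = x"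
proof -
  let ?L = "(\<lambda>x. x 0) ` sft r M"
  have "?L \<subseteq> {1..r}" by (auto simp: sft_def)
  then have fin: "finite (?L \<times> ?L)" by (meson finite_SigmaI finite_atLeastAtMost finite_subset)
  have "\<forall>ab\<in>?L \<times> ?L. \<exists>k. \<forall>x\<in>sft r M. x 0 = snd ab \<longrightarrow> (\<exists>z\<in>sft r M. z 0 = fst ab \<and> (shift ^^ k) z = x)"
  proof
    fix ab assume "ab \<in> ?L \<times> ?L"
    then obtain w w' where "w \<in> sft r M" "w' \<in> sft r M" "ab = (w 0, w' 0)" by auto
    then show "\<exists>k. \<forall>x\<in>sft r M. x 0 = snd ab \<longrightarrow> (\<exists>z\<in>sft r M. z 0 = fst ab \<and> (shift ^^ k) z = x)"
      using connecting_word[of w w'] by auto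
  qed
  from bchoice[OF this] obtain t where t: "\<And>ab x. ab \<in> ?L \<times> ?L \<Longrightarrow> x \<in> sft r M \<Longrightarrow> x 0 = snd ab \<Longrightarrow>
      \<exists>z\<in>sft r M. z 0 = fst ab \<and> (shift ^^ t ab) z = x"
    by blast
  show ?thesis
  proof (rule exI, intro ballI)
    fix x x' assume x: "x \<in> sft r M" "x' \<in> sft r M"
    then have ab: "(x' 0, x 0) \<in> ?L \<times> ?L" by auto
    then have "t (x' 0, x 0) \<le> Max (t ` (?L \<times> ?L))" using fin by (intro Max_ge) auto
    then show "\<exists>k\<le>Max (t ` (?L \<times> ?L)). \<exists>z\<in>sft r M. z 0 = x' 0 \<and> (shift ^^ k) z = x"
      using t[OF ab, of x] x by auto
  qed
qed

text \<open>Transitivity returns a cylinder to itself in at least one step, so the first letter of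
\<open>x\<close> has a predecessor.\<close>

lemma preimages_nonempty: "x \<in> sft r M \<Longrightarrow> preimages r M x \<noteq> {}"
proof -
  assume x: "x \<in> sft r M"
  then obtain k z where "1 \<le> k" "z \<in> sft r M" "(shift ^^ k) z = x" using connecting_word[of x x] by auto
  then have "(shift ^^ (k - 1)) z \<in> preimages r M x"
    using shift_funpow_in_sft[of z r M "k - 1"] by (cases k) (auto simp: preimages_def)
  then show ?thesis by auto
qed

lemma minplus_attained:
  assumes "x \<in> sft r M"
  obtains z where "z \<in> sft r M" "shift z = x" "minplus r M B u x = u z - B z"
proof -
  have "minplus r M B u x \<in> (\<lambda>z. u z - B z) ` preimages r M x"
    unfolding minplus_def using assms by (intro Min_in) (auto simp: finite_preimages preimages_nonempty)
  then show thesis using that by (auto simp: preimages_def)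
qed

lemma minplus_mono:
  assumes "x \<in> sft r M" "\<And>z. z \<in> preimages r M x \<Longrightarrow> u z \<le> v z + k"
  shows "minplus r M B u x \<le> minplus r M B v x + k"
proof -
  obtain z where z: "z \<in> sft r M" "shift z = x" "minplus r M B v x = v z - B z"
    using minplus_attained[OF assms(1), of B v] by blast
  then have "minplus r M B u x \<le> u z - B z" using minplus_le by blast
  then show ?thesis using assms(2)[of z] z by (simp add: preimages_def)
qed

lemma minplus_funpow_mono:
  assumes "\<And>z. z \<in> sft r M \<Longrightarrow> u z \<le> v z + k" "x \<in> sft r M"
  shows "(minplus r M B ^^ n) u x \<le> (minplus r M B ^^ n) v x + k"
  using assms(2)
proof (induction n arbitrary: x)
  case (Suc n)
  then show ?case by (auto intro!: minplus_mono simp: preimages_def)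
qed (use assms in auto)

text \<open>A minimising preimage of \<open>x\<close> becomes a competitor at \<open>x'\<close> after replacing its tail. The term
in \<open>u\<close> gains the factor \<open>l powr \<theta>\<close>, and the term in \<open>B\<close> costs \<open>C\<close>; hence the condition on \<open>H\<close>.\<close>

lemma minplus_cylinder_holder:
  assumes u: "cylinder_holder r M l \<theta> H u"
    and B: "\<And>z z'. z \<in> sft r M \<Longrightarrow> z' \<in> sft r M \<Longrightarrow> z 0 = z' 0 \<Longrightarrow>
      \<bar>B z - B z'\<bar> \<le> C * seq_dist l (shift z) (shift z') powr \<theta>"
    and H: "H * l powr \<theta> + C \<le> H"
  shows "cylinder_holder r M l \<theta> H (minplus r M B u)"
proof -
  have one_sided: "minplus r M B u x' \<le> minplus r M B u x + H * seq_dist l x x' powr \<theta>"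
    if x: "x \<in> sft r M" "x' \<in> sft r M" "x 0 = x' 0" for x x'
  proof -
    obtain z where z: "z \<in> sft r M" "shift z = x" "minplus r M B u x = u z - B z"
      using minplus_attained[OF x(1), of B u] by blast
    define z' where "z' = case_nat (z 0) x'"
    have sz': "shift z' = x'" by (simp add: z'_def shift_def)
    have "M (z 0) (x 0) = 1" using z by (auto simp: sft_def shift_def)
    then have z': "z' \<in> sft r M" using x z by (auto simp: z'_def sft_def split: nat.split)
    have head: "z 0 = z' 0" by (simp add: z'_def)
    let ?d = "seq_dist l x x' powr \<theta>"
    have "seq_dist l z z' powr \<theta> = l powr \<theta> * ?d"
      using seq_dist_same_head[of z z' l] head z sz' l
      by (simp add: powr_mult seq_dist_nonneg)
    then have "\<bar>u z - u z'\<bar> \<le> H * (l powr \<theta> * ?d)"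
      using u z z' head unfolding cylinder_holder_def by metis
    moreover have "\<bar>B z - B z'\<bar> \<le> C * ?d" using B[of z z'] z z' head sz' by simp
    moreover have "(H * l powr \<theta> + C) * ?d \<le> H * ?d" using H by (intro mult_right_mono) auto
    then have "H * (l powr \<theta> * ?d) + C * ?d \<le> H * ?d" by (simp add: algebra_simps)
    moreover have "minplus r M B u x' \<le> u z' - B z'" using minplus_le[OF z'] sz' by simp
    ultimately show ?thesis using z(3) by linarith
  qed
  show ?thesis
    unfolding cylinder_holder_def
  proof (intro ballI impI)
    fix x x' assume x: "x \<in> sft r M" "x' \<in> sft r M" "x 0 = x' 0"
    then show "\<bar>minplus r M B u x - minplus r M B u x'\<bar> \<le> H * seq_dist l x x' powr \<theta>"
      using one_sided[OF x] one_sided[of x' x] seq_dist_commute[of l x x'] by (simp add: abs_le_iff)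
  qed
qed

text \<open>To bound \<open>L\<^sup>n 0\<close> at \<open>x\<close> by its value at \<open>x'\<close>, a connecting word turns \<open>x\<close> into a point \<open>z\<close> of the
cylinder of \<open>x'\<close>. Going from \<open>z\<close> to \<open>x\<close> takes a bounded number of applications of \<open>L\<close>, and so does the
correction of the number of iterations; each of these costs at most \<open>b\<close>. Inside the cylinder the Hoelder
bound applies.\<close>

lemma minplus_iterates_oscillation:
  assumes b: "\<And>z. z \<in> sft r M \<Longrightarrow> \<bar>B z\<bar> \<le> b"
    and H: "\<And>n. cylinder_holder r M l \<theta> H ((minplus r M B ^^ n) (\<lambda>_. 0))" "0 \<le> H" "0 < \<theta>"
  obtains Q where "\<And>n x x'. x \<in> sft r M \<Longrightarrow> x' \<in> sft r M \<Longrightarrow>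
    \<bar>(minplus r M B ^^ n) (\<lambda>_. 0) x - (minplus r M B ^^ n) (\<lambda>_. 0) x'\<bar> \<le> Q"
proof -
  define U where "U n = (minplus r M B ^^ n) (\<lambda>_. 0)" for n
  have U_Suc: "U (Suc n) = minplus r M B (U n)" for n by (simp add: U_def)
  have b0: "0 \<le> b" using b nonempty by (meson abs_ge_zero ex_in_conv order_trans)
  have down: "U n x \<le> U (Suc n) x + b" if "x \<in> sft r M" for n x
    using that
  proof (induction n arbitrary: x)
    case 0
    obtain z where "z \<in> sft r M" "minplus r M B (U 0) x = U 0 z - B z"
      using minplus_attained[OF 0, of B "U 0"] by blast
    then show ?case using b[of z] by (simp add: U_Suc) (simp add: U_def abs_le_iff)
  next
    case (Suc n)
    show ?case unfolding U_Suc[of "Suc n"] unfolding U_Suc[of n]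
      using Suc by (intro minplus_mono) (auto simp: preimages_def U_Suc)
  qed
  have down_k: "U n x \<le> U (n + k) x + real k * b" if "x \<in> sft r M" for n k x
  proof (induction k)
    case (Suc k)
    then show ?case using down[OF that, of "n + k"] by (simp add: algebra_simps)
  qed simp
  have push: "U (n + k) ((shift ^^ k) z) \<le> U n z + real k * b" if "z \<in> sft r M" for n k z
  proof (induction k)
    case (Suc k)
    let ?w = "(shift ^^ k) z"
    have w: "?w \<in> sft r M" using that by (rule shift_funpow_in_sft)
    have "U (n + Suc k) (shift ?w) \<le> U (n + k) ?w - B ?w" using minplus_le[OF w] by (simp add: U_Suc)
    then show ?case using Suc b[OF w] by (simp add: algebra_simps abs_le_iff)
  qed simp
  obtain K where K: "\<forall>x\<in>sft r M. \<forall>x'\<in>sft r M. \<exists>k\<le>K. \<exists>z\<in>sft r M. z 0 = x' 0 \<and> (shift ^^ k) z = x"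
    using uniform_connecting_time by (rule exE)
  have one_sided: "U n x \<le> U n x' + (2 * real K * b + H)" if x: "x \<in> sft r M" "x' \<in> sft r M" for n x x'
  proof -
    obtain k z where k: "k \<le> K" and z: "z \<in> sft r M" "z 0 = x' 0" "(shift ^^ k) z = x"
      using K x by blast
    have "U n x \<le> U n z + 2 * (real k * b)"
      using down_k[OF x(1), of n k] push[OF z(1), of n k] z(3) by simp
    moreover have "\<bar>U n z - U n x'\<bar> \<le> H * seq_dist l z x' powr \<theta>"
      using H(1)[of n] z x unfolding cylinder_holder_def U_def by blast
    moreover have "seq_dist l z x' powr \<theta> \<le> 1"
      using l H(3) by (intro powr_le1) (auto simp: seq_dist_nonneg seq_dist_le_1)
    then have "H * seq_dist l z x' powr \<theta> \<le> H" using H(2) by (simp add: mult_left_le)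
    moreover have "real k * b \<le> real K * b" using k b0 by (intro mult_right_mono) auto
    ultimately show ?thesis by linarith
  qed
  show thesis
  proof (rule that)
    fix n x x' assume x: "x \<in> sft r M" "x' \<in> sft r M"
    show "\<bar>(minplus r M B ^^ n) (\<lambda>_. 0) x - (minplus r M B ^^ n) (\<lambda>_. 0) x'\<bar> \<le> 2 * real K * b + H"
      using one_sided[OF x, of n] one_sided[OF x(2) x(1), of n] by (simp add: U_def abs_le_iff)
  qed
qed

text \<open>Since \<open>L\<close> is monotone and commutes with adding constants, and \<open>L\<^sup>n 0\<close> is constant up to \<open>Q\<close>, the
value of \<open>L\<^sup>m (L\<^sup>n 0)\<close> is that of \<open>L\<^sup>m 0\<close> plus that of \<open>L\<^sup>n 0\<close>, up to \<open>Q\<close>.\<close>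

lemma minplus_bounded_iterates:
  assumes Q: "\<And>n x x'. x \<in> sft r M \<Longrightarrow> x' \<in> sft r M \<Longrightarrow>
    \<bar>(minplus r M B ^^ n) (\<lambda>_. 0) x - (minplus r M B ^^ n) (\<lambda>_. 0) x'\<bar> \<le> Q"
  obtains c where "\<And>n x. x \<in> sft r M \<Longrightarrow> \<bar>(minplus r M B ^^ n) (\<lambda>_. 0) x + real n * c\<bar> \<le> 2 * Q"
proof -
  define U where "U n = (minplus r M B ^^ n) (\<lambda>_. 0)" for n
  obtain x\<^sub>0 where x0: "x\<^sub>0 \<in> sft r M" using nonempty by blast
  have U_add: "U (m + n) = (minplus r M B ^^ m) (U n)" for m n by (simp add: U_def funpow_add)
  have QU: "\<bar>U n x - U n x\<^sub>0\<bar> \<le> Q" if "x \<in> sft r M" for n x using Q[OF that x0] by (simp add: U_def)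
  have "\<bar>U (m + n) x\<^sub>0 - U m x\<^sub>0 - U n x\<^sub>0\<bar> \<le> Q" for m n
  proof -
    have "U (m + n) x\<^sub>0 \<le> U m x\<^sub>0 + (U n x\<^sub>0 + Q)"
      unfolding U_add unfolding U_def[of m]
    proof (rule minplus_funpow_mono[OF _ x0])
      show "U n z \<le> 0 + (U n x\<^sub>0 + Q)" if "z \<in> sft r M" for z using QU[OF that, of n] by linarith
    qed
    moreover have "U m x\<^sub>0 \<le> U (m + n) x\<^sub>0 + (Q - U n x\<^sub>0)"
      unfolding U_add unfolding U_def[of m]
    proof (rule minplus_funpow_mono[OF _ x0])
      show "0 \<le> U n z + (Q - U n x\<^sub>0)" if "z \<in> sft r M" for z using QU[OF that, of n] by linarith
    qed
    ultimately show ?thesis by linarith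
  qed
  then obtain c where c: "\<And>n. \<bar>U n x\<^sub>0 - real n * c\<bar> \<le> Q"
    using quasi_additive_imp_near_linear[of "\<lambda>n. U n x\<^sub>0"] by blast
  show thesis
  proof (rule that)
    fix n x assume "x \<in> sft r M"
    then show "\<bar>(minplus r M B ^^ n) (\<lambda>_. 0) x + real n * - c\<bar> \<le> 2 * Q"
      using QU[of x n] c[of n] by (simp add: U_def abs_le_iff)
  qed
qed

text \<open>Monotone iteration of \<open>u \<mapsto> L u + c\<close>: it increases from a subsolution and stays below the iterates of
a function above it. The limit is a fixed point because only finitely many
preimages compete in the minimum.\<close>

lemma minplus_fixed_point_above_subsolution:
  assumes sub: "\<And>x. x \<in> sft r M \<Longrightarrow> v x \<le> minplus r M B v x + c"
    and super: "\<And>n x. x \<in> sft r M \<Longrightarrow> v x \<le> (minplus r M B ^^ n) v\<^sub>1 x + real n * c"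
      "\<And>n x. x \<in> sft r M \<Longrightarrow> (minplus r M B ^^ n) v\<^sub>1 x + real n * c \<le> Q"
    and lower: "\<And>x. x \<in> sft r M \<Longrightarrow> - Q \<le> v x"
    and holder: "cylinder_holder r M l \<theta> H v"
      "\<And>u. cylinder_holder r M l \<theta> H u \<Longrightarrow> cylinder_holder r M l \<theta> H (minplus r M B u)"
  obtains u where "\<And>x. x \<in> sft r M \<Longrightarrow> u x = minplus r M B u x + c"
    "cylinder_holder r M l \<theta> H u" "\<And>x. x \<in> sft r M \<Longrightarrow> \<bar>u x\<bar> \<le> Q"
proof -
  define V where "V n x = (minplus r M B ^^ n) v x + real n * c" for n x
  have shift_const: "minplus r M B (\<lambda>z. w z + k) x = minplus r M B w x + k" if "x \<in> sft r M" for w k x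
    using minplus_mono[OF that, of "\<lambda>z. w z + k" w k B] minplus_mono[OF that, of w "\<lambda>z. w z + k" "- k" B]
    by simp
  have V_0: "V 0 = v" by (simp add: V_def fun_eq_iff)
  have V_Suc: "V (Suc n) x = minplus r M B (V n) x + c" if "x \<in> sft r M" for n x
    using shift_const[OF that, of "(minplus r M B ^^ n) v" "real n * c"]
    by (simp add: V_def[abs_def] algebra_simps)
  have incr: "V n x \<le> V (Suc n) x" if "x \<in> sft r M" for n x
    using that
  proof (induction n arbitrary: x)
    case (Suc n)
    have "minplus r M B (V n) x \<le> minplus r M B (V (Suc n)) x + 0"
      using Suc by (intro minplus_mono) (auto simp: preimages_def)
    then show ?case using Suc.prems by (simp add: V_Suc)
  qed (simp add: V_Suc V_0 sub)
  have upper: "V n x \<le> Q" if "x \<in> sft r M" for n x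
  proof -
    have "(minplus r M B ^^ n) v x \<le> (minplus r M B ^^ n) v\<^sub>1 x + 0"
      using super(1)[of _ 0] that by (intro minplus_funpow_mono) auto
    then show ?thesis using super(2)[OF that, of n] by (simp add: V_def)
  qed
  have inc: "incseq (\<lambda>n. V n x)" if "x \<in> sft r M" for x
    using incr[OF that] by (rule incseq_SucI)
  have "\<forall>x\<in>sft r M. \<exists>L. (\<lambda>n. V n x) \<longlonglongrightarrow> L"
  proof
    fix x assume x: "x \<in> sft r M"
    show "\<exists>L. (\<lambda>n. V n x) \<longlonglongrightarrow> L"
      using incseq_convergent[OF inc[OF x] allI, of Q] upper[OF x] by metis
  qed
  from bchoice[OF this] obtain u where u: "\<forall>x\<in>sft r M. (\<lambda>n. V n x) \<longlonglongrightarrow> u x" by (rule exE)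
  have V_le_u: "V n x \<le> u x" if "x \<in> sft r M" for n x
    using inc[OF that] u that by (intro incseq_le) auto
  show thesis
  proof (rule that)
    fix x assume x: "x \<in> sft r M"
    have lim_Suc: "(\<lambda>n. V (Suc n) x) \<longlonglongrightarrow> u x" using u x by (intro LIMSEQ_Suc) auto
    show "u x = minplus r M B u x + c"
    proof (rule antisym)
      have "V (Suc n) x \<le> minplus r M B u x + c" for n
        using minplus_mono[OF x, of "V n" u 0 B] V_le_u x by (simp add: V_Suc preimages_def)
      then show "u x \<le> minplus r M B u x + c" using lim_Suc by (intro LIMSEQ_le_const2) auto
      show "minplus r M B u x + c \<le> u x"
      proof (rule field_le_epsilon)
        fix e :: real assume "0 < e"
        have "\<forall>\<^sub>F n in sequentially. \<forall>z\<in>preimages r M x. u z < V n z + e"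
        proof (rule eventually_ball_finite[OF finite_preimages], rule ballI)
          fix z assume "z \<in> preimages r M x"
          then have "(\<lambda>n. V n z) \<longlonglongrightarrow> u z" using u by (simp add: preimages_def)
          from order_tendstoD(1)[OF this, of "u z - e"]
          show "\<forall>\<^sub>F n in sequentially. u z < V n z + e"
            using \<open>0 < e\<close> by (auto elim: eventually_mono)
        qed
        then obtain n where "\<forall>z\<in>preimages r M x. u z < V n z + e"
          by (auto simp: eventually_sequentially)
        then have "minplus r M B u x \<le> minplus r M B (V n) x + e"
          using x by (intro minplus_mono) (auto intro: less_imp_le)
        then have "minplus r M B u x + c \<le> V (Suc n) x + e" using x by (simp add: V_Suc)
        then show "minplus r M B u x + c \<le> u x + e" using V_le_u[OF x, of "Suc n"] by linarith
      qed
    qed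
    have "u x \<le> Q" using u x upper[OF x] by (intro LIMSEQ_le_const2[of "\<lambda>n. V n x"]) auto
    moreover have "- Q \<le> u x" using lower[OF x] V_le_u[OF x, of 0] by (simp add: V_0)
    ultimately show "\<bar>u x\<bar> \<le> Q" by linarith
  next
    have iter: "cylinder_holder r M l \<theta> H ((minplus r M B ^^ n) v)" for n
      by (induction n) (auto simp: holder)
    show "cylinder_holder r M l \<theta> H u"
      unfolding cylinder_holder_def
    proof (intro ballI impI)
      fix x x' assume x: "x \<in> sft r M" "x' \<in> sft r M" "x 0 = x' 0"
      have "(\<lambda>n. \<bar>V n x - V n x'\<bar>) \<longlonglongrightarrow> \<bar>u x - u x'\<bar>"
        using u x by (intro tendsto_intros) auto
      moreover have "\<bar>V n x - V n x'\<bar> \<le> H * seq_dist l x x' powr \<theta>" for n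
        using iter[of n] x by (auto simp: V_def cylinder_holder_def)
      ultimately show "\<bar>u x - u x'\<bar> \<le> H * seq_dist l x x' powr \<theta>"
        by (intro LIMSEQ_le_const2) auto
    qed
  qed
qed

text \<open>The constant \<open>H\<close> is the fixed point of \<open>H \<mapsto> H * l powr \<theta> + C\<close>. The subsolution to start from is
the infimum of the functions \<open>L\<^sup>n 0 + n c\<close>: applying \<open>L + c\<close> to it drops the term \<open>n = 0\<close> from
the infimum, which can only increase it.\<close>

lemma minplus_additive_eigenfunction:
  assumes bound: "\<And>z. z \<in> sft r M \<Longrightarrow> \<bar>B z\<bar> \<le> b"
    and B: "\<And>z z'. z \<in> sft r M \<Longrightarrow> z' \<in> sft r M \<Longrightarrow> z 0 = z' 0 \<Longrightarrow>
      \<bar>B z - B z'\<bar> \<le> C * seq_dist l (shift z) (shift z') powr \<theta>"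
    and "0 \<le> C" "0 < \<theta>"
  obtains u c where "holder_on \<theta> (sft r M) (seq_dist l) u"
    "\<And>x. x \<in> sft r M \<Longrightarrow> u x = minplus r M B u x + c"
proof -
  define H where "H = C / (1 - l powr \<theta>)"
  have "l powr \<theta> < 1 powr \<theta>" using l \<open>0 < \<theta>\<close> by (intro powr_less_mono2) auto
  then have l\<theta>: "l powr \<theta> < 1" by simp
  then have H0: "0 \<le> H" using \<open>0 \<le> C\<close> by (simp add: H_def)
  have "H * (1 - l powr \<theta>) = C" using l\<theta> by (simp add: H_def)
  then have H: "H * l powr \<theta> + C \<le> H" by (simp add: algebra_simps)
  have step: "cylinder_holder r M l \<theta> H (minplus r M B u)" if "cylinder_holder r M l \<theta> H u" for u
    using that B H by (rule minplus_cylinder_holder)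
  define U where "U n = (minplus r M B ^^ n) (\<lambda>_. 0)" for n
  have U_holder: "cylinder_holder r M l \<theta> H (U n)" for n
  proof (induction n)
    case 0
    show ?case using H0 by (simp add: U_def cylinder_holder_def)
  qed (simp add: U_def step)
  obtain Q where Q: "\<And>n x x'. x \<in> sft r M \<Longrightarrow> x' \<in> sft r M \<Longrightarrow> \<bar>U n x - U n x'\<bar> \<le> Q"
    unfolding U_def
    using minplus_iterates_oscillation[OF bound U_holder[unfolded U_def] H0 \<open>0 < \<theta>\<close>] by blast
  obtain c where c: "\<And>n x. x \<in> sft r M \<Longrightarrow> \<bar>U n x + real n * c\<bar> \<le> 2 * Q"
    unfolding U_def using minplus_bounded_iterates[OF Q[unfolded U_def]] by blast
  define v where "v x = (INF n. U n x + real n * c)" for x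
  have bdd: "bdd_below (range (\<lambda>n. U n x + real n * c))" if "x \<in> sft r M" for x
  proof (rule bdd_belowI2)
    show "- (2 * Q) \<le> U n x + real n * c" for n using c[OF that, of n] by linarith
  qed
  have v_le: "v x \<le> U n x + real n * c" if "x \<in> sft r M" for x n
    unfolding v_def using bdd[OF that] by (intro cINF_lower) auto
  have v_ge: "a \<le> v x" if "\<And>n. a \<le> U n x + real n * c" for a x
    unfolding v_def using that by (intro cINF_greatest) auto
  have sub: "v x \<le> minplus r M B v x + c" if x: "x \<in> sft r M" for x
  proof -
    obtain z where z: "z \<in> sft r M" "shift z = x" "minplus r M B v x = v z - B z"
      using minplus_attained[OF x, of B v] by blast
    have "v x + B z - c \<le> v z"
    proof (rule v_ge)
      fix n
      have "U (Suc n) x \<le> U n z - B z" using minplus_le[OF z(1), of B "U n"] z(2) by (simp add: U_def)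
      then show "v x + B z - c \<le> U n z + real n * c"
        using v_le[OF x, of "Suc n"] by (simp add: algebra_simps)
    qed
    then show ?thesis using z(3) by linarith
  qed
  have v_holder: "cylinder_holder r M l \<theta> H v"
  proof -
    have "v x - H * seq_dist l x x' powr \<theta> \<le> v x'"
      if x: "x \<in> sft r M" "x' \<in> sft r M" "x 0 = x' 0" for x x'
    proof (rule v_ge)
      fix n
      have "\<bar>U n x - U n x'\<bar> \<le> H * seq_dist l x x' powr \<theta>"
        using U_holder[of n] x by (simp add: cylinder_holder_def)
      then show "v x - H * seq_dist l x x' powr \<theta> \<le> U n x' + real n * c"
        using v_le[OF x(1), of n] by linarith
    qed
    moreover have "seq_dist l x x' = seq_dist l x' x" for x x' by (rule seq_dist_commute)
    ultimately show ?thesis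
      unfolding cylinder_holder_def abs_le_iff by (smt (verit, best))
  qed
  have bnds: "U n x + real n * c \<le> 2 * Q" "- (2 * Q) \<le> v x" if "x \<in> sft r M" for n x
  proof -
    show "U n x + real n * c \<le> 2 * Q" using c[OF that, of n] by linarith
    show "- (2 * Q) \<le> v x"
    proof (rule v_ge)
      show "- (2 * Q) \<le> U n x + real n * c" for n using c[OF that, of n] by linarith
    qed
  qed
  obtain u where u: "\<And>x. x \<in> sft r M \<Longrightarrow> u x = minplus r M B u x + c"
    "cylinder_holder r M l \<theta> H u" "\<And>x. x \<in> sft r M \<Longrightarrow> \<bar>u x\<bar> \<le> 2 * Q"
    using minplus_fixed_point_above_subsolution[OF sub v_le[unfolded U_def] bnds(1)[unfolded U_def]
        bnds(2) v_holder step] by blast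
  have "holder_on \<theta> (sft r M) (seq_dist l) u"
    unfolding holder_on_def
  proof (intro exI ballI)
    fix x x' assume x: "x \<in> sft r M" "x' \<in> sft r M"
    let ?m = "max H (4 * Q)"
    show "\<bar>u x - u x'\<bar> \<le> ?m * seq_dist l x x' powr \<theta>"
    proof (cases "x 0 = x' 0")
      case True
      then have "\<bar>u x - u x'\<bar> \<le> H * seq_dist l x x' powr \<theta>" using u(2) x by (simp add: cylinder_holder_def)
      also have "\<dots> \<le> ?m * seq_dist l x x' powr \<theta>" by (intro mult_right_mono) auto
      finally show ?thesis .
    next
      case False
      then show ?thesis using u(3)[OF x(1)] u(3)[OF x(2)] by (simp add: seq_dist_different_head)
    qed
  qed
  with u(1) show thesis using that by blast
qed

end

section \<open>Calibrated functions\<close>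

text \<open>The equation for \<open>u\<close> with an arbitrary constant in place of \<open>\<beta>\<^sub>A\<close>.\<close>

definition calibrated ::
    "nat \<Rightarrow> (nat \<Rightarrow> nat \<Rightarrow> nat) \<Rightarrow> (sequence \<times> sequence \<Rightarrow> real) \<Rightarrow> real \<Rightarrow> (sequence \<Rightarrow> real) \<Rightarrow> bool" where
  "calibrated r M A c u \<longleftrightarrow>
     (\<forall>x\<in>sft r M. is_min (u x) ((\<lambda>y. u (tau (y, x)) - A (y, x) + c) ` dual_fibre r M x))"

lemma tau_eq: "tau (y, x) = case_nat (y 0) x"
  by (auto simp: tau_def fun_eq_iff split: nat.split)

lemma tau_in_preimages: "(y, x) \<in> hat_sft r M \<Longrightarrow> tau (y, x) \<in> preimages r M x"
  by (auto simp: tau_eq preimages_def hat_sft_def sft_def dual_sft_def shift_def split: nat.split)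

lemma tau_in_sft: "p \<in> hat_sft r M \<Longrightarrow> tau p \<in> sft r M"
  using tau_in_preimages[of "fst p" "snd p" r M] by (simp add: preimages_def)

lemma snd_in_sft: "p \<in> hat_sft r M \<Longrightarrow> snd p \<in> sft r M"
  by (auto simp: hat_sft_def)

lemma in_dual_fibre_iff: "y \<in> dual_fibre r M x \<longleftrightarrow> (y, x) \<in> hat_sft r M"
  by (auto simp: dual_fibre_def hat_sft_def)

lemma pair_in_hat_sft_of_preimage:
  assumes "z \<in> sft r M" "y \<in> dual_sft r M" "y 0 = z 0"
  shows "(y, shift z) \<in> hat_sft r M" "tau (y, shift z) = z"
  using assms by (auto simp: hat_sft_def shift_in_sft tau_eq fun_eq_iff split: nat.split)
    (auto simp: sft_def shift_def)

context transitive_subshift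
begin

text \<open>A past is built by choosing preimages one after the other.\<close>

lemma exists_past:
  assumes "z \<in> sft r M"
  shows "\<exists>y\<in>dual_sft r M. y 0 = z 0"
proof -
  have "\<forall>x\<in>sft r M. \<exists>g. g \<in> sft r M \<and> shift g = x"
    using preimages_nonempty by (auto simp: preimages_def)
  from bchoice[OF this] obtain g where g: "\<forall>x\<in>sft r M. g x \<in> sft r M \<and> shift (g x) = x" by (rule exE)
  define y where "y j = (g ^^ j) z 0" for j
  have in_sft: "(g ^^ j) z \<in> sft r M" for j by (induction j) (use g assms in auto)
  have "M (y (Suc j)) (y j) = 1" for j
  proof -
    have "shift ((g ^^ Suc j) z) = (g ^^ j) z" using g in_sft[of j] by simp
    then have "(g ^^ Suc j) z 1 = y j" by (simp add: shift_def y_def fun_eq_iff)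
    moreover have "M ((g ^^ Suc j) z 0) ((g ^^ Suc j) z 1) = 1" using in_sft[of "Suc j"] by (simp add: sft_def)
    ultimately show ?thesis by (simp add: y_def)
  qed
  moreover have "y j \<in> {1..r}" for j using in_sft[of j] by (simp add: y_def sft_def)
  ultimately have "y \<in> dual_sft r M" by (simp add: dual_sft_def)
  then show ?thesis by (intro bexI[of _ y]) (simp_all add: y_def)
qed

text \<open>The competing pasts, paired with the point \<open>shift z\<close>, form a closed subset of the compact set
\<open>hat_sft r M\<close>, so the maximum is attained.\<close>

lemma best_past_exists:
  fixes A :: "sequence \<times> sequence \<Rightarrow> real"
  assumes A: "continuous_on (hat_sft r M) A" and z: "z \<in> sft r M"
  shows "\<exists>y. y \<in> dual_sft r M \<and> y 0 = z 0 \<and>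
    (\<forall>y'\<in>dual_sft r M. y' 0 = z 0 \<longrightarrow> A (y', shift z) \<le> A (y, shift z))"
proof -
  let ?F = "hat_sft r M \<inter> ({p. fst p 0 = z 0} \<inter> {p. snd p = shift z})"
  have "closed {p :: sequence \<times> sequence. fst p 0 = z 0}"
    by (rule closed_coordinates_constraint[where P = "\<lambda>a _. a = z 0" and g = "\<lambda>_. 0"])
      (simp_all add: continuous_on_coordinate continuous_on_fst)
  moreover have "closed {p :: sequence \<times> sequence. snd p = shift z}"
  proof -
    have "closed {p :: sequence \<times> sequence. snd p j = shift z j}" for j
      by (rule closed_coordinates_constraint[where P = "\<lambda>a _. a = shift z j" and g = "\<lambda>_. 0"])
        (simp_all add: continuous_on_coordinate continuous_on_snd)
    then have "closed (\<Inter>j. {p :: sequence \<times> sequence. snd p j = shift z j})" by blast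
    also have "(\<Inter>j. {p. snd p j = shift z j}) = {p :: sequence \<times> sequence. snd p = shift z}"
      by (auto simp: fun_eq_iff)
    finally show ?thesis .
  qed
  ultimately have "compact ?F" by (intro compact_Int_closed compact_hat_sft closed_Int)
  moreover have "?F \<noteq> {}" using exists_past[OF z] pair_in_hat_sft_of_preimage(1)[OF z] by force
  moreover have "continuous_on ?F A" using A by (rule continuous_on_subset) auto
  ultimately obtain p where p: "p \<in> ?F" "\<forall>q\<in>?F. A q \<le> A p"
    using continuous_attains_sup by metis
  have "p = (fst p, shift z)" using p(1) by (auto simp: prod_eq_iff)
  moreover have "fst p \<in> dual_sft r M" using p(1) by (auto simp: hat_sft_def)
  ultimately show ?thesis
    using p pair_in_hat_sft_of_preimage(1)[OF z] by (intro exI[of _ "fst p"]) auto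
qed

lemma holder_imp_continuous_on_sft:
  assumes "holder_on \<theta> (sft r M) (seq_dist l) u" "0 < \<theta>"
  shows "continuous_on (sft r M) u"
  using assms seq_dist_nonneg[OF l(1)] seq_dist_small[OF l] by (rule continuous_on_holder)

lemma holder_imp_continuous_on_hat_sft:
  assumes "holder_on \<theta> (hat_sft r M) (hat_dist l) A" "0 < \<theta>"
  shows "continuous_on (hat_sft r M) A"
proof (rule continuous_on_holder[OF assms _ hat_dist_small[OF l]])
  show "0 \<le> hat_dist l p q" for p q by (simp add: hat_dist_def seq_dist_nonneg l le_max_iff_disj)
qed

text \<open>The weight \<open>B z\<close> is the value of \<open>A\<close> at the best past of \<open>z\<close>. The pasts that compete
depend only on \<open>z 0\<close>, which makes \<open>B\<close> inherit the Hoelder bound of \<open>A\<close> on each cylinder.\<close>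

lemma calibrated_exists:
  assumes A: "holder_on \<theta> (hat_sft r M) (hat_dist l) A" and \<theta>: "0 < \<theta>"
  obtains u c where "holder_on \<theta> (sft r M) (seq_dist l) u" "calibrated r M A c u"
proof -
  note cont = holder_imp_continuous_on_hat_sft[OF A \<theta>]
  have "\<forall>z\<in>sft r M. \<exists>y. y \<in> dual_sft r M \<and> y 0 = z 0 \<and>
      (\<forall>y'\<in>dual_sft r M. y' 0 = z 0 \<longrightarrow> A (y', shift z) \<le> A (y, shift z))"
    using best_past_exists[OF cont] by blast
  from bchoice[OF this] obtain Y where Y: "\<forall>z\<in>sft r M. Y z \<in> dual_sft r M \<and> Y z 0 = z 0 \<and>
      (\<forall>y'\<in>dual_sft r M. y' 0 = z 0 \<longrightarrow> A (y', shift z) \<le> A (Y z, shift z))"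
    by (rule exE)
  define B where "B z = A (Y z, shift z)" for z
  have Y_hat: "(Y z, shift z) \<in> hat_sft r M" if "z \<in> sft r M" for z
    using Y that by (intro pair_in_hat_sft_of_preimage(1)) auto
  have B_ge: "A (y, shift z) \<le> B z" if "z \<in> sft r M" "y \<in> dual_sft r M" "y 0 = z 0" for y z
    using Y that by (simp add: B_def)
  obtain C where C: "\<And>p q. p \<in> hat_sft r M \<Longrightarrow> q \<in> hat_sft r M \<Longrightarrow>
      \<bar>A p - A q\<bar> \<le> C * hat_dist l p q powr \<theta>"
    using A by (auto simp: holder_on_def)
  have one_sided: "B z \<le> B z' + \<bar>C\<bar> * seq_dist l (shift z) (shift z') powr \<theta>"
    if z: "z \<in> sft r M" "z' \<in> sft r M" "z 0 = z' 0" for z z'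
  proof -
    have y: "Y z \<in> dual_sft r M" "Y z 0 = z' 0" using Y z by auto
    let ?d = "seq_dist l (shift z) (shift z')"
    have "hat_dist l (Y z, shift z) (Y z, shift z') = ?d"
      using seq_dist_nonneg[OF l(1), of "shift z" "shift z'"] by (simp add: hat_dist_def seq_dist_def)
    then have "\<bar>A (Y z, shift z) - A (Y z, shift z')\<bar> \<le> C * ?d powr \<theta>"
      using C[OF Y_hat[OF z(1)] pair_in_hat_sft_of_preimage(1)[OF z(2) y]] by simp
    also have "\<dots> \<le> \<bar>C\<bar> * ?d powr \<theta>" by (intro mult_right_mono) auto
    finally have "A (Y z, shift z) \<le> A (Y z, shift z') + \<bar>C\<bar> * ?d powr \<theta>" by linarith
    then show ?thesis using B_ge[OF z(2) y] by (simp add: B_def)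
  qed
  have B_holder: "\<bar>B z - B z'\<bar> \<le> \<bar>C\<bar> * seq_dist l (shift z) (shift z') powr \<theta>"
    if "z \<in> sft r M" "z' \<in> sft r M" "z 0 = z' 0" for z z'
    using one_sided[OF that] one_sided[OF that(2,1) that(3)[symmetric]] seq_dist_commute[of l "shift z" "shift z'"]
    by (simp add: abs_le_iff)
  obtain b where "\<And>p. p \<in> hat_sft r M \<Longrightarrow> norm (A p) \<le> b"
    using compact_imp_bounded[OF compact_continuous_image[OF cont compact_hat_sft]]
    by (auto simp: bounded_iff)
  then have B_bound: "\<bar>B z\<bar> \<le> b" if "z \<in> sft r M" for z using Y_hat[OF that] by (simp add: B_def)
  obtain u c where u: "holder_on \<theta> (sft r M) (seq_dist l) u"
    "\<And>x. x \<in> sft r M \<Longrightarrow> u x = minplus r M B u x + c"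
    using minplus_additive_eigenfunction[OF B_bound B_holder abs_ge_zero \<theta>] by blast
  have "calibrated r M A c u"
    unfolding calibrated_def is_min_def
  proof (intro ballI conjI)
    fix x assume x: "x \<in> sft r M"
    obtain z where z: "z \<in> sft r M" "shift z = x" "minplus r M B u x = u z - B z"
      using minplus_attained[OF x, of B u] by blast
    have "tau (Y z, x) = z" "Y z \<in> dual_fibre r M x"
      using pair_in_hat_sft_of_preimage[OF z(1), of "Y z"] Y z by (auto simp: in_dual_fibre_iff)
    moreover have "u x = u z - A (Y z, x) + c" using u(2)[OF x] z by (simp add: B_def)
    ultimately show "u x \<in> (\<lambda>y. u (tau (y, x)) - A (y, x) + c) ` dual_fibre r M x"
      by (intro image_eqI[of _ _ "Y z"]) auto
    fix s assume "s \<in> (\<lambda>y. u (tau (y, x)) - A (y, x) + c) ` dual_fibre r M x"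
    then obtain y where y: "(y, x) \<in> hat_sft r M" and s: "s = u (tau (y, x)) - A (y, x) + c"
      by (auto simp: in_dual_fibre_iff)
    let ?w = "tau (y, x)"
    have w: "?w \<in> sft r M" "shift ?w = x" using tau_in_preimages[OF y] by (auto simp: preimages_def)
    have "A (y, x) \<le> B ?w"
      using B_ge[OF w(1), of y] y w(2) by (simp add: tau_eq hat_sft_def)
    moreover have "minplus r M B u x \<le> u ?w - B ?w" using minplus_le[OF w(1)] w(2) by metis
    ultimately show "u x \<le> s" using u(2)[OF x] s by linarith
  qed
  with u(1) show thesis using that by blast
qed

section \<open>The constant is the maximal holonomic integral\<close>

lemma holonomic_iff:
  "\<mu> \<in> holonomic r M l \<longleftrightarrow> prob_space \<mu> \<and> space \<mu> = hat_sft r M \<and>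
     sets \<mu> = sigma_sets (hat_sft r M) {U. openin (top_of_set (hat_sft r M)) U} \<and>
     (\<forall>f :: sequence \<Rightarrow> real. continuous_on (sft r M) f \<longrightarrow> (\<integral>p. f (tau p) \<partial>\<mu>) = (\<integral>p. f (snd p) \<partial>\<mu>))"
  by (simp add: holonomic_def hat_topology_eq[OF l] sft_topology_eq[OF l])

lemma continuous_on_comp_tau:
  "continuous_on (sft r M) f \<Longrightarrow> continuous_on (hat_sft r M) (\<lambda>p. f (tau p))"
  by (erule continuous_on_compose2) (auto intro: continuous_on_tau tau_in_sft)

lemma continuous_on_comp_snd:
  "continuous_on (sft r M) f \<Longrightarrow> continuous_on (hat_sft r M) (\<lambda>p. f (snd p))"
  by (erule continuous_on_compose2) (auto intro: snd_in_sft continuous_on_snd)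

lemma holonomic_integrable:
  fixes f :: "sequence \<times> sequence \<Rightarrow> real"
  assumes "\<mu> \<in> holonomic r M l" "continuous_on (hat_sft r M) f"
  shows "integrable \<mu> f"
proof -
  have \<mu>: "prob_space \<mu>" "space \<mu> = hat_sft r M"
    "sets \<mu> = sigma_sets (hat_sft r M) {U. openin (top_of_set (hat_sft r M)) U}"
    using assms(1) by (auto simp: holonomic_iff)
  interpret prob_space \<mu> by (rule \<mu>(1))
  obtain b where "\<And>p. p \<in> hat_sft r M \<Longrightarrow> norm (f p) \<le> b"
    using compact_imp_bounded[OF compact_continuous_image[OF assms(2) compact_hat_sft]]
    by (auto simp: bounded_iff)
  then have "AE p in \<mu>. norm (f p) \<le> b" using \<mu>(2) by auto
  then show ?thesis
    using borel_measurable_of_continuous_on[OF assms(2) \<mu>(2,3)] by (rule integrable_const_bound)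
qed

text \<open>The coboundary \<open>u \<circ> tau - u \<circ> snd\<close> in the calibration inequality has integral zero, by
holonomy.\<close>

lemma holonomic_integral_le:
  assumes "continuous_on (hat_sft r M) A" "continuous_on (sft r M) u" "calibrated r M A c u"
    and \<mu>: "\<mu> \<in> holonomic r M l"
  shows "(\<integral>p. A p \<partial>\<mu>) \<le> c"
proof -
  interpret prob_space \<mu> using \<mu> by (simp add: holonomic_iff)
  note int = holonomic_integrable[OF \<mu> continuous_on_comp_tau[OF assms(2)]]
    holonomic_integrable[OF \<mu> continuous_on_comp_snd[OF assms(2)]]
  have "A p \<le> u (tau p) - u (snd p) + c" if "p \<in> hat_sft r M" for p
  proof -
    obtain y x where p: "p = (y, x)" by (cases p)
    then have "x \<in> sft r M" "y \<in> dual_fibre r M x"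
      using that snd_in_sft[OF that] by (auto simp: in_dual_fibre_iff)
    then have "u x \<le> u (tau (y, x)) - A (y, x) + c"
      using assms(3) unfolding calibrated_def is_min_def by blast
    then show ?thesis by (simp add: p)
  qed
  then have "(\<integral>p. A p \<partial>\<mu>) \<le> (\<integral>p. u (tau p) - u (snd p) + c \<partial>\<mu>)"
    using \<mu> int holonomic_integrable[OF \<mu> assms(1)]
    by (intro integral_mono) (auto simp: holonomic_iff)
  also have "\<dots> = (\<integral>p. u (tau p) \<partial>\<mu>) - (\<integral>p. u (snd p) \<partial>\<mu>) + c"
    using int by (simp add: prob_space)
  also have "\<dots> = c" using \<mu> assms(2) by (simp add: holonomic_iff)
  finally show ?thesis .
qed

text \<open>The orbit \<open>x (Suc n) = tau (Y (x n), x n)\<close> follows the minimising pasts \<open>Y\<close>. Since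
\<open>tau (p n) = snd (p (Suc n))\<close>, the averages of both \<open>f \<circ> tau - f \<circ> snd\<close> and \<open>A - c\<close> telescope.\<close>

lemma maximizing_holonomic_exists:
  assumes A: "continuous_on (hat_sft r M) A" and u: "continuous_on (sft r M) u"
    and cal: "calibrated r M A c u"
  obtains \<mu> where "\<mu> \<in> holonomic r M l" "(\<integral>p. A p \<partial>\<mu>) = c"
proof -
  have "\<forall>x\<in>sft r M. \<exists>y. (y, x) \<in> hat_sft r M \<and> u x = u (tau (y, x)) - A (y, x) + c"
    using cal unfolding calibrated_def is_min_def in_dual_fibre_iff[symmetric] by blast
  from bchoice[OF this] obtain Y where
    Y: "\<forall>x\<in>sft r M. (Y x, x) \<in> hat_sft r M \<and> u x = u (tau (Y x, x)) - A (Y x, x) + c"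
    by (rule exE)
  obtain x\<^sub>0 where x0: "x\<^sub>0 \<in> sft r M" using nonempty by blast
  define x where "x n = ((\<lambda>x. tau (Y x, x)) ^^ n) x\<^sub>0" for n
  define p where "p n = (Y (x n), x n)" for n
  have x_in: "x n \<in> sft r M" for n
    by (induction n) (use x0 Y tau_in_sft in \<open>auto simp: x_def\<close>)
  have p_in: "p n \<in> hat_sft r M" for n using Y x_in[of n] by (simp add: p_def)
  have tau_p: "tau (p n) = x (Suc n)" and snd_p: "snd (p n) = x n" for n
    by (simp_all add: p_def x_def)
  have A_p: "A (p n) = u (x (Suc n)) - u (x n) + c" for n
    using Y x_in[of n] tau_p[of n] by (simp add: p_def)
  obtain \<phi> :: "sequence \<times> sequence \<Rightarrow> real" where \<phi>: "continuous_on (hat_sft r M) \<phi>" "inj_on \<phi> (hat_sft r M)"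
    by (rule hat_sft_embeds_in_reals)
  obtain \<mu> s where s: "strict_mono s" and \<mu>: "prob_space \<mu>" "space \<mu> = hat_sft r M"
    "sets \<mu> = sigma_sets (hat_sft r M) {U. openin (top_of_set (hat_sft r M)) U}"
    and lim: "\<forall>f :: sequence \<times> sequence \<Rightarrow> real. continuous_on (hat_sft r M) f \<longrightarrow>
       (\<lambda>n. (\<Sum>i\<le>s n. f (p i)) / real (Suc (s n))) \<longlonglongrightarrow> (\<integral>q. f q \<partial>\<mu>)"
    by (rule empirical_measures_accumulate[where p = p, OF compact_hat_sft \<phi> p_in])
  have telescope: "(\<Sum>i\<le>n. f (x (Suc i)) - f (x i)) = f (x (Suc n)) - f (x 0)" for f :: "sequence \<Rightarrow> real" and n
    by (induction n) auto
  have avg0: "(\<lambda>n. (\<Sum>i\<le>s n. f (x (Suc i)) - f (x i)) / real (Suc (s n))) \<longlonglongrightarrow> 0"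
    if f: "continuous_on (sft r M) f" for f :: "sequence \<Rightarrow> real"
  proof -
    obtain b where "\<And>q. q \<in> hat_sft r M \<Longrightarrow> norm (f (snd q)) \<le> b"
      using compact_imp_bounded[OF compact_continuous_image[OF continuous_on_comp_snd[OF f] compact_hat_sft]]
      by (auto simp: bounded_iff)
    then have "\<bar>f (x n)\<bar> \<le> b" for n using p_in[of n] snd_p[of n] by fastforce
    then show ?thesis
      unfolding telescope by (rule bounded_increment_average_tendsto_0[where g = "\<lambda>n. f (x n)", OF _ s])
  qed
  have "(\<integral>q. f (tau q) \<partial>\<mu>) = (\<integral>q. f (snd q) \<partial>\<mu>)"
    if f: "continuous_on (sft r M) f" for f :: "sequence \<Rightarrow> real"
  proof -
    have diff: "(\<lambda>n. (\<Sum>i\<le>s n. f (tau (p i))) / real (Suc (s n)) - (\<Sum>i\<le>s n. f (snd (p i))) / real (Suc (s n)))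
        \<longlonglongrightarrow> (\<integral>q. f (tau q) \<partial>\<mu>) - (\<integral>q. f (snd q) \<partial>\<mu>)"
      by (intro tendsto_diff lim[rule_format] continuous_on_comp_tau continuous_on_comp_snd f)
    have eq: "(\<Sum>i\<le>s n. f (tau (p i))) / real (Suc (s n)) - (\<Sum>i\<le>s n. f (snd (p i))) / real (Suc (s n))
        = (\<Sum>i\<le>s n. f (x (Suc i)) - f (x i)) / real (Suc (s n))" for n
      by (simp only: tau_p snd_p sum_subtractf diff_divide_distrib)
    show ?thesis using LIMSEQ_unique[OF diff[unfolded eq] avg0[OF f]] by linarith
  qed
  then have "\<mu> \<in> holonomic r M l" using \<mu> by (simp add: holonomic_iff)
  moreover have "(\<integral>q. A q \<partial>\<mu>) = c"
  proof -
    have eq: "(\<Sum>i\<le>s n. A (p i)) / real (Suc (s n)) =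
        (\<Sum>i\<le>s n. u (x (Suc i)) - u (x i)) / real (Suc (s n)) + c" for n
      by (simp add: A_p sum.distrib add_divide_distrib del: of_nat_Suc)
    have "(\<lambda>n. (\<Sum>i\<le>s n. u (x (Suc i)) - u (x i)) / real (Suc (s n)) + c) \<longlonglongrightarrow> 0 + c"
      by (intro tendsto_add avg0 u tendsto_const)
    then show ?thesis using LIMSEQ_unique[OF lim[rule_format, OF A, unfolded eq]] by simp
  qed
  ultimately show thesis using that by blast
qed

lemma beta_eq_of_calibrated:
  assumes A: "continuous_on (hat_sft r M) A" and u: "continuous_on (sft r M) u"
    and cal: "calibrated r M A c u"
  shows "beta r M l A = c"
  unfolding beta_def
proof (rule Greatest_equality)
  show "c \<in> (\<lambda>\<mu>. \<integral>p. A p \<partial>\<mu>) ` holonomic r M l"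
    using maximizing_holonomic_exists[OF assms] by blast
  show "b \<le> c" if "b \<in> (\<lambda>\<mu>. \<integral>p. A p \<partial>\<mu>) ` holonomic r M l" for b
    using that holonomic_integral_le[OF assms] by blast
qed

end

theorem theorem4:
  fixes r :: nat and M :: "nat \<Rightarrow> nat \<Rightarrow> nat" and l \<theta> :: real
    and A :: "sequence \<times> sequence \<Rightarrow> real"
  assumes "\<And>i j. i \<in> {1..r} \<Longrightarrow> j \<in> {1..r} \<Longrightarrow> M i j \<in> {0, 1}"
    and "0 < l" and "l < 1"
    and "sft r M \<noteq> {}"
    and "transitive_sft r M l"
    and "0 < \<theta>"
    and "holder_on \<theta> (hat_sft r M) (hat_dist l) A"
  shows "\<exists>u :: sequence \<Rightarrow> real.
           holder_on \<theta> (sft r M) (seq_dist l) u \<and>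
           (\<forall>x \<in> sft r M.
              is_min (u x) ((\<lambda>y. u (tau (y, x)) - A (y, x) + beta r M l A) ` dual_fibre r M x))"
proof -
  interpret transitive_subshift r M l
    using assms by unfold_locales
  obtain u c where u: "holder_on \<theta> (sft r M) (seq_dist l) u" "calibrated r M A c u"
    using calibrated_exists assms by blast
  moreover have "beta r M l A = c"
    using beta_eq_of_calibrated u assms holder_imp_continuous_on_sft holder_imp_continuous_on_hat_sft by blast
  ultimately show ?thesis unfolding calibrated_def by blast
qed

end
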